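(* Let $(a_j)_{j\ge1}$ be positive weights and $v:\{1,2,\dots\}\to\mathbb R$ a function satisfying the profile assumption stated in the context, with $\gamma_c,q_c,\alpha_c,\rho_c$, $k_n(\rho)$, $\mu^\rho_{n,k}$, $\mu^{\rho,[r]}_{n,k}$ and $\omega_n=\omega_n(\rho)$ as defined there. Fix $\rho>\rho_c$ with $\rho>0$ and let $k=k_n(\rho)$. As $n\to\infty$: (i) The optimal fraction $\alpha^*(\rho)=\lim_{n\to\infty}k_n(\rho)/n$ is pinned at the boundary value: \[ \alpha^*(\rho)=\alpha_c,\qquad \left|\frac{k_n(\rho)}n-\alpha_c\right|=O_\rho(\omega_n). \] (ii) For every fixed $r\ge1$, \[ d_{\mathrm{TV}}\!\left(\mu^{\rho,[r]}_{n,k_n(\rho)},q_c^{\otimes r}\right)=O_{\rho,r}(\omega_n). \] (iii) There exists a deterministic sequence $M_n\to\infty$ such that, with $I_n=\{i\in\{1,\dots,k\}:J_i>M_n\}$ and $(J_1,\dots,J_k)\sim\mu^\rho_{n,k}$, \[ \mathbb E\frac{|I_n|}{k}=o(1),\qquad \mathbb E\left|\frac1n\sum_{i\in I_n}v(J_i)-(\rho-\rho_c)\right|=o(1). \]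
   Context: Profile assumption on $(a,v)$: the weights $a_j$ are positive; $v$ is increasing and, with $\Delta v(j)=v(j+1)-v(j)$ and $\Delta^2v(j)=\Delta v(j+1)-\Delta v(j)$, \[ \frac{v(j)}j\to\infty,\qquad \frac{\Delta v(j)}{v(j)}\to0,\qquad \Delta^2v(j)\to0\qquad(j\to\infty); \] the limit $\gamma_c=\lim_{j\to\infty}[-\log a_j]/v(j)$ exists and is finite; and, with $Z_\gamma(x)=\sum_{j\ge1}a_jx^je^{\gamma v(j)}\in(0,\infty]$ for $x>0$, the set $\{x>0:Z_{\gamma_c}(x)<\infty\}$ is nonempty and open (i.e. the family in $x$ with $\gamma=\gamma_c$ fixed is nonempty and regular). Boundary quantities: the equation $Z_{\gamma_c}(x)=1$ has a unique solution $x_c>0$. Let $q_c(j)=a_jx_c^je^{\gamma_cv(j)}$, a probability law on $\{1,2,\dots\}$, write $\mathbb E_c$ for expectation when $J\sim q_c$, and set $\alpha_c=1/\mathbb E_cJ$, $\rho_c=\mathbb E_cv(J)/\mathbb E_cJ$. Microcanonical quantities: for $\rho>0$ and $1\le k\le n$, \[ W^{(a,v)}_{n,k}(\rho)=\sum_{\substack{j_1+\cdots+j_k=n,\ j_i\ge1\\ |\sum_i v(j_i)-\rho n|\le 1}}\ \prod_{i=1}^k a_{j_i}. \] Whenever $W^{(a,v)}_{n,k}(\rho)>0$, $\mu^\rho_{n,k}$ is the probability law of $(J_1,\dots,J_k)$ on the constraint set $\{j_i\ge 1,\ \sum_i j_i=n,\ |\sum_iv(j_i)-\rho n|\le1\}$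 with weights proportional to $\prod_ia_{j_i}$, and for $1\le r\le k$, $\mu^{\rho,[r]}_{n,k}$ is the joint law of its first $r$ coordinates. $k_n(\rho)$ is any maximizer of $k\mapsto W^{(a,v)}_{n,k}(\rho)$ over $1\le k\le n$. Error scale: for $\rho>\rho_c$, let $s_n=s_n(\rho)$ be the smallest integer $m\ge1$ such that $v(m)-\rho_cm\ge(\rho-\rho_c)n$, let $\xi_n=v(s_n)-\rho_cs_n-(\rho-\rho_c)n$, and set \[ \omega_n(\rho)=\left(\frac{-\log q_c(s_n)+\log n}{n}\right)^{1/2}+\frac{\xi_n}{n}. \] $d_{\mathrm{TV}}(\mu,\pi)=\frac12\sum_z|\mu(z)-\pi(z)|$. The model $(a,v)$ is fixed; implicit constants may depend on it, and subscripts record any additional dependence. *)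

theory Defs
  imports "HOL-Probability.Probability" "HOL-Library.Landau_Symbols"
begin

text \<open>
  Weights and profiles are functions on \<^typ>\<open>nat\<close> of which only the values at arguments
  \<open>\<ge> 1\<close> matter.
\<close>

definition fdiff :: "(nat \<Rightarrow> real) \<Rightarrow> nat \<Rightarrow> real"
  where "fdiff v j = v (j + 1) - v j"

definition Z :: "(nat \<Rightarrow> real) \<Rightarrow> (nat \<Rightarrow> real) \<Rightarrow> real \<Rightarrow> real \<Rightarrow> ennreal"
  where "Z a v \<gamma> x = (\<Sum>\<^sub>\<infinity>j\<in>{1..}. ennreal (a j * x ^ j * exp (\<gamma> * v j)))"

definition gamma_c :: "(nat \<Rightarrow> real) \<Rightarrow> (nat \<Rightarrow> real) \<Rightarrow> real"
  where "gamma_c a v = lim (\<lambda>j. - ln (a j) / v j)"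

text \<open>``Increasing'' is read in the weak sense; this includes the strictly increasing case.\<close>

locale profile =
  fixes a v :: "nat \<Rightarrow> real"
  assumes a_pos: "\<And>j. j \<ge> 1 \<Longrightarrow> a j > 0"
    and v_mono: "mono_on {1..} v"
    and v_superlinear: "filterlim (\<lambda>j. v j / real j) at_top sequentially"
    and fdiff_v_small: "(\<lambda>j. fdiff v j / v j) \<longlonglongrightarrow> 0"
    and fdiff2_v_small: "(\<lambda>j. fdiff (fdiff v) j) \<longlonglongrightarrow> 0"
    and gamma_c_exists: "convergent (\<lambda>j. - ln (a j) / v j)"
    and Z_domain_nonempty: "{x. x > 0 \<and> Z a v (gamma_c a v) x < \<infinity>} \<noteq> {}"
    and Z_domain_open: "open {x. x > 0 \<and> Z a v (gamma_c a v) x < \<infinity>}"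

definition x_c :: "(nat \<Rightarrow> real) \<Rightarrow> (nat \<Rightarrow> real) \<Rightarrow> real"
  where "x_c a v = (THE x. x > 0 \<and> Z a v (gamma_c a v) x = 1)"

text \<open>
  Under \<^locale>\<open>profile\<close> the function below is nonnegative and has total mass
  \<open>Z a v (gamma_c a v) (x_c a v) = 1\<close>, which is what \<^const>\<open>embed_pmf\<close> requires.
\<close>

definition q_c :: "(nat \<Rightarrow> real) \<Rightarrow> (nat \<Rightarrow> real) \<Rightarrow> nat pmf"
  where "q_c a v =
    embed_pmf (\<lambda>j. if j \<ge> 1 then a j * x_c a v ^ j * exp (gamma_c a v * v j) else 0)"

definition alpha_c :: "(nat \<Rightarrow> real) \<Rightarrow> (nat \<Rightarrow> real) \<Rightarrow> real"
  where "alpha_c a v = 1 / measure_pmf.expectation (q_c a v) real"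

definition rho_c :: "(nat \<Rightarrow> real) \<Rightarrow> (nat \<Rightarrow> real) \<Rightarrow> real"
  where "rho_c a v =
    measure_pmf.expectation (q_c a v) v / measure_pmf.expectation (q_c a v) real"

text \<open>A tuple \<open>(j\<^sub>1, \<dots>, j\<^sub>k)\<close> is a list of length \<open>k\<close>; list positions are counted from 0.\<close>

definition constraint_set :: "(nat \<Rightarrow> real) \<Rightarrow> real \<Rightarrow> nat \<Rightarrow> nat \<Rightarrow> nat list set"
  where "constraint_set v \<rho> n k =
    {js. length js = k \<and> (\<forall>j\<in>set js. j \<ge> 1) \<and> sum_list js = n
       \<and> \<bar>(\<Sum>i<k. v (js ! i)) - \<rho> * real n\<bar> \<le> 1}"

definition W :: "(nat \<Rightarrow> real) \<Rightarrow> (nat \<Rightarrow> real) \<Rightarrow> real \<Rightarrow> nat \<Rightarrow> nat \<Rightarrow> real"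
  where "W a v \<rho> n k = (\<Sum>js\<in>constraint_set v \<rho> n k. \<Prod>i<k. a (js ! i))"

text \<open>Meaningful only if \<open>W a v \<rho> n k > 0\<close>; otherwise \<^const>\<open>embed_pmf\<close> is unspecified.\<close>

definition mu :: "(nat \<Rightarrow> real) \<Rightarrow> (nat \<Rightarrow> real) \<Rightarrow> real \<Rightarrow> nat \<Rightarrow> nat \<Rightarrow> nat list pmf"
  where "mu a v \<rho> n k =
    embed_pmf (\<lambda>js. if js \<in> constraint_set v \<rho> n k
                    then (\<Prod>i<k. a (js ! i)) / W a v \<rho> n k else 0)"

definition mu_marginal ::
    "(nat \<Rightarrow> real) \<Rightarrow> (nat \<Rightarrow> real) \<Rightarrow> real \<Rightarrow> nat \<Rightarrow> nat \<Rightarrow> nat \<Rightarrow> nat list pmf"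
  where "mu_marginal a v \<rho> n k r = map_pmf (take r) (mu a v \<rho> n k)"

definition is_maximizer ::
    "(nat \<Rightarrow> real) \<Rightarrow> (nat \<Rightarrow> real) \<Rightarrow> real \<Rightarrow> nat \<Rightarrow> nat \<Rightarrow> bool"
  where "is_maximizer a v \<rho> n k \<longleftrightarrow> is_arg_max (W a v \<rho> n) (\<lambda>k. 1 \<le> k \<and> k \<le> n) k"

definition s_idx :: "(nat \<Rightarrow> real) \<Rightarrow> (nat \<Rightarrow> real) \<Rightarrow> real \<Rightarrow> nat \<Rightarrow> nat"
  where "s_idx a v \<rho> n =
    (LEAST m. m \<ge> 1 \<and> v m - rho_c a v * real m \<ge> (\<rho> - rho_c a v) * real n)"

definition xi :: "(nat \<Rightarrow> real) \<Rightarrow> (nat \<Rightarrow> real) \<Rightarrow> real \<Rightarrow> nat \<Rightarrow> real"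
  where "xi a v \<rho> n =
    v (s_idx a v \<rho> n) - rho_c a v * real (s_idx a v \<rho> n) - (\<rho> - rho_c a v) * real n"

definition omega :: "(nat \<Rightarrow> real) \<Rightarrow> (nat \<Rightarrow> real) \<Rightarrow> real \<Rightarrow> nat \<Rightarrow> real"
  where "omega a v \<rho> n =
    sqrt ((- ln (pmf (q_c a v) (s_idx a v \<rho> n)) + ln (real n)) / real n)
      + xi a v \<rho> n / real n"

definition d_TV :: "'a pmf \<Rightarrow> 'a pmf \<Rightarrow> real"
  where "d_TV p q = (1 / 2) * (\<Sum>\<^sub>\<infinity>z. \<bar>pmf p z - pmf q z\<bar>)"

definition large_idx :: "real \<Rightarrow> nat list \<Rightarrow> nat set"
  where "large_idx M js = {i. i < length js \<and> real (js ! i) > M}"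

end

theory Submission
  imports Defs "HOL-Real_Asymp.Real_Asymp"
begin

text \<open>
  Write \<open>q\<close> for the boundary law and \<open>m\<close> for its mean. On the constraint set \<open>\<Sum> j_i = n\<close> and
  \<open>\<Sum> v j_i\<close> is \<open>\<rho> n\<close> up to 1, so \<open>\<Prod> a j_i\<close> and \<open>\<Prod> q j_i\<close> differ there by a factor that is the
  same for all tuples, up to \<open>exp \<bar>\<gamma>\<^sub>c\<bar>\<close>. Hence the microcanonical law is, up to bounded factors, the
  product law \<open>q\<close> on \<open>k\<close>-tuples conditioned on the constraint event, the maximizer \<open>k_n\<close> nearly
  maximizes the probability of that event, and everything rests on one lower bound for it
  (\<open>hit_prob_maximizer_lower\<close>): it is at least \<open>exp (- C cost n)\<close>, where
  \<open>cost n = - ln q(s_n) + ln n\<close> and \<open>\<omega>_n \<ge> sqrt (cost n / n)\<close>.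

  For the lower bound one coordinate is given the value \<open>s_n\<close>, and about \<open>(n - s_n) / m\<close> coordinates
  are sampled independently from \<open>q\<close>. By Chebyshev's inequality both totals of the sample
  are typically within \<open>O(sqrt n)\<close> of their means. A sum of order \<open>sqrt n\<close> is kept in reserve for a
  deterministic list which repairs both constraints (\<open>completion_list\<close>). The
  logarithmic price of a list is controlled by its two totals, so this repair costs a factor
  \<open>exp (- C sqrt n)\<close>. That is affordable without any local limit theorem: \<open>v\<close> is at most quadratic,
  hence \<open>s_n\<close> is at least of order \<open>sqrt n\<close>, and \<open>q\<close> has exponential tails, hence already
  \<open>- ln q(s_n)\<close> is at least of order \<open>sqrt n\<close>. The overshoot \<open>\<xi>_n\<close> is \<open>O(sqrt n)\<close> as well, because
  small second differences force \<open>(\<Delta>v)^2 = O(v)\<close>.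

  For the upper bounds, passing from \<open>q\<close> to a law with density at most \<open>K\<close> changes exponential moments
  by the factor \<open>K\<close> only. If \<open>X\<close> is a sum over at most \<open>n\<close> blocks of a centred function with exponential
  moments, then Jensen's inequality gives \<open>\<theta> E\<bar>X\<bar> \<le> O(cost n) + O(n \<theta>^2)\<close>, and the choice
  \<open>\<theta> = sqrt (cost n / n)\<close> yields \<open>E\<bar>X\<bar> / n = O(sqrt (cost n / n))\<close> (\<open>concentration\<close>). With \<open>X = \<Sum> (J_i - m)\<close>,
  which equals \<open>n - k m\<close>, this is the statement on \<open>k_n / n\<close>. With the extremal
  test function of the total variation distance on disjoint blocks of length \<open>r\<close>, and the invariance of the
  microcanonical law under cyclic shifts, it is the statement on marginals. With \<open>v\<close> truncated at a
  fixed level it shows that the coordinates below the level carry \<open>v\<close>-density close to \<open>\<rho>\<^sub>c\<close>, so the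
  others carry \<open>\<rho> - \<rho>\<^sub>c\<close>; the level then goes to infinity along a diagonal sequence.
\<close>

section \<open>Growth of the profile and lists with prescribed totals\<close>

context profile
begin

lemma v_telescope: "m \<le> n \<Longrightarrow> v n - v m = (\<Sum>i=m..<n. fdiff v i)"
  using sum_Suc_diff'[of m n v] by (simp add: fdiff_def)

lemma fdiff_telescope: "m \<le> n \<Longrightarrow> fdiff v n - fdiff v m = (\<Sum>i=m..<n. fdiff (fdiff v) i)"
  using sum_Suc_diff'[of m n "fdiff v"] by (simp add: fdiff_def)

lemma v_le: "1 \<le> i \<Longrightarrow> i \<le> j \<Longrightarrow> v i \<le> v j"
  using v_mono by (auto simp: mono_on_def)

lemma fdiff_nonneg: "1 \<le> j \<Longrightarrow> 0 \<le> fdiff v j"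
  using v_le[of j "j+1"] by (simp add: fdiff_def)

lemma v_eventually_ge_linear: "\<forall>\<^sub>F j in sequentially. K * real j \<le> v j"
proof -
  have "\<forall>\<^sub>F j in sequentially. K \<le> v j / real j"
    using v_superlinear by (auto simp: filterlim_at_top)
  thus ?thesis using eventually_gt_at_top[of 0]
    by eventually_elim (auto simp: field_simps)
qed

lemma fdiff2_eventually_le: "\<epsilon> > 0 \<Longrightarrow> \<forall>\<^sub>F j in sequentially. \<bar>fdiff (fdiff v) j\<bar> \<le> \<epsilon>"
  using order_tendstoD(2)[OF tendsto_rabs[OF fdiff2_v_small], of \<epsilon>]
  by (auto elim!: eventually_mono)

lemma fdiff_le_of_fdiff2_le:
  assumes "\<And>j. j \<ge> N \<Longrightarrow> fdiff (fdiff v) j \<le> \<epsilon>" "N \<le> i" "i \<le> j"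
  shows "fdiff v j \<le> fdiff v i + \<epsilon> * real (j - i)"
proof -
  have "(\<Sum>i=i..<j. fdiff (fdiff v) i) \<le> (\<Sum>i=i..<j. \<epsilon>)"
    by (intro sum_mono) (use assms in auto)
  thus ?thesis using fdiff_telescope[of i j] assms by (simp add: mult.commute)
qed

text \<open>
  If the second differences were eventually nonpositive, \<open>v\<close> would grow at most linearly. Replacing the pair
  \<open>(j+1, j+1)\<close> by \<open>(j, j+2)\<close> keeps the sum of a list and raises its \<open>v\<close>-total by the second difference at \<open>j\<close>,
  so this is a step size of at most 1 at which \<open>v\<close>-totals can be adjusted.
\<close>

lemma exists_small_positive_fdiff2:
  obtains j where "j \<ge> 1" "0 < fdiff (fdiff v) j" "fdiff (fdiff v) j \<le> 1"
proof -
  obtain N where N: "\<And>j. j \<ge> N \<Longrightarrow> \<bar>fdiff (fdiff v) j\<bar> \<le> 1"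
    using fdiff2_eventually_le[of 1] by (auto simp: eventually_sequentially)
  have "\<exists>j\<ge>N+1. 0 < fdiff (fdiff v) j"
  proof (rule ccontr)
    assume "\<not> ?thesis"
    hence neg: "fdiff (fdiff v) j \<le> 0" if "j \<ge> N+1" for j
      using that by (meson not_less)
    have D: "fdiff v j \<le> fdiff v (N+1)" if "j \<ge> N+1" for j
      using fdiff_le_of_fdiff2_le[of "N+1" 0 "N+1" j] neg that by simp
    have *: "v j \<le> v (N+1) + fdiff v (N+1) * real (j - (N+1))" if "j \<ge> N+1" for j
    proof -
      have "(\<Sum>i=N+1..<j. fdiff v i) \<le> (\<Sum>i=N+1..<j. fdiff v (N+1))"
        by (intro sum_mono D) auto
      thus ?thesis using v_telescope[OF that] by (simp add: mult.commute)
    qed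
    define K where "K = \<bar>v (N+1)\<bar> + fdiff v (N+1) + 1"
    have D0: "fdiff v (N+1) \<ge> 0" by (rule fdiff_nonneg) simp
    obtain M where M: "\<And>j. j \<ge> M \<Longrightarrow> K * real j \<le> v j"
      using v_eventually_ge_linear[of K] by (auto simp: eventually_sequentially)
    define j where "j = max M (N+1)"
    have j: "j \<ge> M" "j \<ge> N+1" by (auto simp: j_def)
    have "v j \<le> \<bar>v (N+1)\<bar> * real j + fdiff v (N+1) * real j"
    proof -
      have "v (N+1) \<le> \<bar>v (N+1)\<bar> * real j"
        using j(2) mult_left_mono[of 1 "real j" "\<bar>v (N+1)\<bar>"] by simp
      moreover have "fdiff v (N+1) * real (j - (N+1)) \<le> fdiff v (N+1) * real j"
        by (intro mult_left_mono D0) simp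
      ultimately show ?thesis using *[OF j(2)] by linarith
    qed
    also have "\<dots> < K * real j" using j by (simp add: K_def algebra_simps)
    finally show False using M[OF j(1)] by simp
  qed
  then obtain j where "j \<ge> N+1" "0 < fdiff (fdiff v) j" by blast
  with N[of j] that[of j] show ?thesis by auto
qed

text \<open>
  Second differences are eventually at most 1; sum twice. The consequence that matters is \<open>s_n \<ge> c sqrt n\<close>.
\<close>

lemma v_le_quadratic: obtains C where "C > 0" "\<And>j. j \<ge> 1 \<Longrightarrow> v j \<le> C * (real j)\<^sup>2"
proof -
  obtain N0 where N0: "\<And>j. j \<ge> N0 \<Longrightarrow> \<bar>fdiff (fdiff v) j\<bar> \<le> 1"
    using fdiff2_eventually_le[of 1] by (auto simp: eventually_sequentially)
  define N where "N = N0 + 1"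
  have N: "fdiff (fdiff v) j \<le> 1" if "j \<ge> N" for j
    using N0[of j] that by (auto simp: N_def abs_le_iff)
  define A where "A = fdiff v N"
  have A: "A \<ge> 0" unfolding A_def by (rule fdiff_nonneg) (simp add: N_def)
  define C where "C = \<bar>v N\<bar> + A + 1"
  have "v j \<le> C * (real j)\<^sup>2" if j: "j \<ge> 1" for j
  proof -
    have j2: "real j \<le> (real j)\<^sup>2" "1 \<le> (real j)\<^sup>2"
      using j by (auto simp: power2_eq_square one_le_power simp flip: of_nat_mult)
    have vN: "v N \<le> \<bar>v N\<bar> * (real j)\<^sup>2"
      using mult_left_mono[OF j2(2), of "\<bar>v N\<bar>"] by simp
    have AA: "0 \<le> A * real j" "A * real j \<le> A * (real j)\<^sup>2" using A j2 by (auto intro: mult_left_mono)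
    show ?thesis
    proof (cases "j \<le> N")
      case True
      hence "v j \<le> v N" using v_le j by simp
      moreover have "0 \<le> (A + 1) * (real j)\<^sup>2" using A by simp
      ultimately show ?thesis using vN by (simp add: C_def algebra_simps)
    next
      case False
      have "(\<Sum>i=N..<j. fdiff v i) \<le> (\<Sum>i=N..<j. A + real j)"
      proof (intro sum_mono)
        fix i assume "i \<in> {N..<j}"
        thus "fdiff v i \<le> A + real j"
          using fdiff_le_of_fdiff2_le[of N 1 N i] N by (simp add: A_def)
      qed
      hence "v j - v N \<le> real (j - N) * (A + real j)" using v_telescope[of N j] False by simp
      also have "\<dots> \<le> real j * (A + real j)" using A by (intro mult_right_mono) auto
      also have "\<dots> = A * real j + (real j)\<^sup>2" by (simp add: algebra_simps power2_eq_square)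
      finally show ?thesis using vN AA by (simp add: C_def algebra_simps)
    qed
  qed
  thus ?thesis using that[of C] A by (simp add: C_def)
qed

text \<open>
  Far out the first difference changes by at most \<open>1/2\<close> per step, so to the left of \<open>j\<close> it stays above half of its value
  \<open>D\<close> at \<open>j\<close> on a stretch of length about \<open>D\<close>. As \<open>v\<close> is monotone, it has to climb by about \<open>D^2 / 2\<close> there.
\<close>

lemma fdiff_square_le: "\<forall>\<^sub>F j in sequentially. (fdiff v j)\<^sup>2 \<le> 9 * v j"
proof -
  obtain N0 where N0: "\<And>j. j \<ge> N0 \<Longrightarrow> \<bar>fdiff (fdiff v) j\<bar> \<le> 1/2"
    using fdiff2_eventually_le[of "1/2"] by (auto simp: eventually_sequentially)
  define N where "N = N0 + 1"
  have N: "fdiff (fdiff v) j \<le> 1/2" if "j \<ge> N" for j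
    using N0[of j] that by (auto simp: N_def abs_le_iff)
  have "\<forall>\<^sub>F j in sequentially. real j \<ge> 2 * (fdiff v N + real N)"
    using eventually_ge_at_top[of "nat \<lceil>2 * (fdiff v N + real N)\<rceil>"]
    by eventually_elim linarith
  moreover have "\<forall>\<^sub>F j in sequentially. 1 * real j \<le> v j" by (rule v_eventually_ge_linear)
  moreover have "\<forall>\<^sub>F j in sequentially. real j \<ge> \<bar>v 1\<bar> + 1"
    using eventually_ge_at_top[of "nat \<lceil>\<bar>v 1\<bar> + 1\<rceil>"]
    by eventually_elim linarith
  ultimately show ?thesis using eventually_ge_at_top[of N]
  proof eventually_elim
    case (elim j)
    define D where "D = fdiff v j"
    have D0: "D \<ge> 0" unfolding D_def using elim by (intro fdiff_nonneg) (simp add: N_def)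
    \<comment> \<open>the length of the stretch to the left of \<open>j\<close> on which the first difference is at least \<open>D/2\<close>\<close>
    define t where "t = nat \<lfloor>D\<rfloor>"
    have t: "real t \<le> D" "D \<le> real t + 1" using D0 by (auto simp: t_def)
    have "D \<le> fdiff v N + 1/2 * real (j - N)"
      unfolding D_def using elim by (intro fdiff_le_of_fdiff2_le[OF N]) auto
    also have "\<dots> \<le> real j - real N"
    proof -
      have eq: "real (j - N) = real j - real N" using elim by (auto simp: of_nat_diff)
      have "2 * fdiff v N + real N \<le> real j"
        using elim(1) of_nat_0_le_iff[of N] by (simp add: algebra_simps)
      thus ?thesis unfolding eq by (simp add: field_simps)
    qed
    finally have tj: "N + t \<le> j" using t elim by linarith
    have "(\<Sum>i=j-t..<j. D/2) \<le> (\<Sum>i=j-t..<j. fdiff v i)"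
    proof (intro sum_mono)
      fix i assume i: "i \<in> {j-t..<j}"
      hence "D \<le> fdiff v i + 1/2 * real (j - i)"
        unfolding D_def using tj by (intro fdiff_le_of_fdiff2_le[OF N]) auto
      moreover have "real (j - i) \<le> D" using i t by (simp add: of_nat_diff) linarith
      ultimately show "D/2 \<le> fdiff v i" by linarith
    qed
    hence "real t * (D/2) \<le> v j - v (j - t)"
      using v_telescope[of "j-t" j] tj by simp
    moreover have "v 1 \<le> v (j - t)" using tj by (intro v_le) (auto simp: N_def)
    moreover have "(D - 1) * (D/2) \<le> real t * (D/2)" using t D0 by (intro mult_right_mono) auto
    ultimately have "D\<^sup>2 - D \<le> 2 * (v j - v 1)"
      by (simp add: algebra_simps power2_eq_square)
    moreover have "2 * D \<le> D\<^sup>2 + 1" using zero_le_power2[of "D - 1"]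
      by (simp add: power2_eq_square algebra_simps)
    ultimately have "D\<^sup>2 \<le> 1 + 4 * (v j - v 1)" by linarith
    also have "\<dots> \<le> 9 * v j"
      using elim(2,3) by (simp add: algebra_simps)
    finally show ?case by (simp only: D_def)
  qed
qed

text \<open>
  The list consists of a coarse part, a fine part and a few ones. In the coarse part, exchanging \<open>j2\<close> copies of \<open>j1\<close>
  for \<open>j1\<close> copies of \<open>j2\<close> preserves the sum and raises the \<open>v\<close>-total by a fixed \<open>d\<close>. The fine part is \<open>m\<close>
  pairs, each either \<open>(j+1, j+1)\<close> or \<open>(j, j+2)\<close>, and sweeps a range of length at least \<open>d\<close> in steps of at most 1.
  The ones absorb the remainder of the sum modulo \<open>j1 j2\<close>, and \<open>c\<close> absorbs the contributions of bounded size.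
\<close>

lemma completion_list:
  assumes j12: "j1 \<ge> 1" "j2 \<ge> 1" and ratio: "v j1 / real j1 < v j2 / real j2"
  obtains c where "\<And>x y. c \<le> real x \<Longrightarrow> v j1 / real j1 * real x + c \<le> y \<Longrightarrow>
    y \<le> v j2 / real j2 * real x - c \<Longrightarrow>
    \<exists>L. (\<forall>j\<in>set L. j \<ge> 1) \<and> sum_list L = x \<and> \<bar>sum_list (map v L) - y\<bar> \<le> 1"
proof -
  obtain j where j: "j \<ge> 1" "0 < fdiff (fdiff v) j" "fdiff (fdiff v) j \<le> 1"
    by (rule exists_small_positive_fdiff2)
  define e where "e = fdiff (fdiff v) j"
  have e: "0 < e" "e \<le> 1" "e = v (j+2) - 2 * v (j+1) + v j" using j by (auto simp: e_def fdiff_def)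
  define d where "d = real j1 * v j2 - real j2 * v j1"
  have d: "d > 0" using ratio j12 by (simp add: d_def field_simps)
  \<comment> \<open>number of pairs that make the fine part sweep at least one coarse step\<close>
  define m where "m = nat \<lceil>d / e\<rceil>"
  have m: "d \<le> real m * e"
    using real_nat_ceiling_ge[of "d / e"] e(1) unfolding m_def by (simp only: pos_divide_le_eq)
  define g where "g = 2 * m * (j+1)"
  define r1 where "r1 = v j1 / real j1"
  define r2 where "r2 = v j2 / real j2"
  define P where "P = j1 * j2"
  have P: "P > 0" using j12 by (simp add: P_def)
  define c where "c = 2 * real m * \<bar>v (j+1)\<bar> + real P * \<bar>v 1\<bar> + (\<bar>r1\<bar> + \<bar>r2\<bar>) * (real g + real P) + real g"
  show ?thesis
  proof (rule that[of c])
    fix x :: nat and y :: real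
    assume xc: "c \<le> real x" and y1: "v j1 / real j1 * real x + c \<le> y"
      and y2: "y \<le> v j2 / real j2 * real x - c"
    have "real g \<le> c" unfolding c_def by simp
    hence gx: "g \<le> x" using xc by linarith
    define t where "t = (x - g) div P"
    define rm where "rm = (x - g) mod P"
    have xsplit: "x = g + t * P + rm" using gx by (simp add: t_def rm_def)
    have rm: "rm \<le> P" using P by (simp add: rm_def less_imp_le)
    define base where "base = 2 * real m * v (j+1) + real rm * v 1 + real t * real j2 * v j1"
    have r1x: "r1 * real x = real t * real j2 * v j1 + r1 * (real g + real rm)"
      using j12 unfolding xsplit by (simp add: r1_def P_def field_simps)
    have r2x: "r2 * real x = real t * real j1 * v j2 + r2 * (real g + real rm)"
      using j12 unfolding xsplit by (simp add: r2_def P_def field_simps)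
    have rb: "r * (real g + real rm) \<le> \<bar>r\<bar> * (real g + real P)"
      "- (\<bar>r\<bar> * (real g + real P)) \<le> r * (real g + real rm)" for r :: real
    proof -
      have "\<bar>r * (real g + real rm)\<bar> \<le> \<bar>r\<bar> * (real g + real P)"
        unfolding abs_mult using rm by (intro mult_left_mono) auto
      thus "r * (real g + real rm) \<le> \<bar>r\<bar> * (real g + real P)"
        "- (\<bar>r\<bar> * (real g + real P)) \<le> r * (real g + real rm)"
        by (simp_all only: abs_le_iff) simp
    qed
    have v1b: "real rm * v 1 \<le> real P * \<bar>v 1\<bar>" "- (real P * \<bar>v 1\<bar>) \<le> real rm * v 1"
    proof -
      have "\<bar>real rm * v 1\<bar> \<le> real P * \<bar>v 1\<bar>"
        unfolding abs_mult using rm by (intro mult_mono) auto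
      thus "real rm * v 1 \<le> real P * \<bar>v 1\<bar>" "- (real P * \<bar>v 1\<bar>) \<le> real rm * v 1"
        by (simp_all only: abs_le_iff) simp
    qed
    have vmb: "2 * real m * v (j+1) \<le> 2 * real m * \<bar>v (j+1)\<bar>"
      "- (2 * real m * \<bar>v (j+1)\<bar>) \<le> 2 * real m * v (j+1)"
      using mult_left_mono[of "v (j+1)" "\<bar>v (j+1)\<bar>" "2 * real m"]
        mult_left_mono[of "- \<bar>v (j+1)\<bar>" "v (j+1)" "2 * real m"] by auto
    define X1 X2 X3 X4 where "X1 = 2 * real m * \<bar>v (j+1)\<bar>" and "X2 = real P * \<bar>v 1\<bar>"
      and "X3 = \<bar>r1\<bar> * (real g + real P)" and "X4 = \<bar>r2\<bar> * (real g + real P)"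
    note X_defs = X1_def[symmetric] X2_def[symmetric] X3_def[symmetric] X4_def[symmetric]
    have X_pos: "0 \<le> X3" "0 \<le> X4" "0 \<le> real g" by (auto simp: X3_def X4_def)
    have c_exp: "c = X1 + X2 + X3 + X4 + real g"
      by (simp add: c_def X1_def X2_def X3_def X4_def algebra_simps)
    note bounds = rb[of r1, unfolded X_defs] rb[of r2, unfolded X_defs] v1b[unfolded X_defs]
      vmb[unfolded X_defs] X_pos
    have base_le: "base \<le> y"
      using y1 r1x bounds unfolding base_def c_exp r1_def[symmetric] by linarith
    have "base + real t * d = 2 * real m * v (j+1) + real rm * v 1 + real t * real j1 * v j2"
      by (simp add: base_def d_def algebra_simps)
    hence le_top: "y \<le> base + real t * d"
      using y2 r2x bounds unfolding c_exp r2_def[symmetric] by linarith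
    \<comment> \<open>number of coarse exchanges; the rest \<open>z\<close> is then left to the fine part\<close>
    define w where "w = nat \<lfloor>(y - base) / d\<rfloor>"
    have w: "real w * d \<le> y - base" "y - base \<le> real w * d + d"
    proof -
      have "0 \<le> (y - base) / d" using base_le d by simp
      hence "real w \<le> (y - base) / d" "(y - base) / d \<le> real w + 1"
        unfolding w_def by linarith+
      thus "real w * d \<le> y - base" "y - base \<le> real w * d + d"
        using d by (simp_all add: field_simps)
    qed
    have weight: "w \<le> t"
    proof -
      have "real w * d \<le> real t * d" using w le_top by linarith
      thus ?thesis using d by simp
    qed
    define z where "z = y - base - real w * d"
    have z: "0 \<le> z" "z \<le> d" using w by (auto simp: z_def)
    define l where "l = nat \<lfloor>z / e\<rfloor>"
    have l: "real l * e \<le> z" "z \<le> real l * e + e"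
    proof -
      have "0 \<le> z / e" using z e by simp
      hence "real l \<le> z / e" "z / e \<le> real l + 1"
        unfolding l_def by linarith+
      thus "real l * e \<le> z" "z \<le> real l * e + e"
        using e(1) by (simp_all add: field_simps)
    qed
    have lm: "l \<le> m"
    proof -
      have "real l * e \<le> real m * e" using l z m by linarith
      thus ?thesis using e by simp
    qed
    define L where "L = replicate l j @ replicate l (j+2) @ replicate (2*(m-l)) (j+1)
        @ replicate rm 1 @ replicate ((t-w)*j2) j1 @ replicate (w*j1) j2"
    obtain m' where m': "m = l + m'" using lm le_Suc_ex by blast
    obtain t' where t': "t = w + t'" using weight le_Suc_ex by blast
    have "sum_list (map v L) = base + real w * d + real l * e"
      unfolding L_def base_def d_def e(3) m' t'
      by (simp add: sum_list_replicate algebra_simps)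
    hence V: "\<bar>sum_list (map v L) - y\<bar> \<le> 1" using l e(2) unfolding z_def by linarith
    have S: "sum_list L = x"
      unfolding xsplit g_def L_def m' t' by (simp add: sum_list_replicate P_def algebra_simps)
    have "\<forall>i\<in>set L. i \<ge> 1" using j(1) j12 by (auto simp: L_def)
    thus "\<exists>L. (\<forall>j\<in>set L. j \<ge> 1) \<and> sum_list L = x \<and> \<bar>sum_list (map v L) - y\<bar> \<le> 1"
      using S V by blast
  qed
qed

end

section \<open>The boundary law\<close>

context profile
begin

text \<open>
  The terms of \<^const>\<open>Z\<close> at \<open>\<gamma>\<^sub>c\<close>, extended by 0 to the index 0; at \<open>x = x_c\<close> this is the mass function of \<^const>\<open>q_c\<close>.
\<close>

definition weight :: "real \<Rightarrow> nat \<Rightarrow> real"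
  where "weight x j = (if j \<ge> 1 then a j * x ^ j * exp (gamma_c a v * v j) else 0)"

lemma weight_nonneg: "x \<ge> 0 \<Longrightarrow> weight x j \<ge> 0"
  using a_pos[of j] by (auto simp: weight_def)

lemma Z_eq_nn_integral:
  "Z a v (gamma_c a v) x = (\<integral>\<^sup>+ j. ennreal (weight x j) \<partial>count_space UNIV)"
proof -
  have "Z a v (gamma_c a v) x = (\<Sum>\<^sub>\<infinity>j. ennreal (weight x j))"
    unfolding Z_def by (intro infsum_cong_neutral) (auto simp: weight_def)
  also have "\<dots> = (\<Sum>j. ennreal (weight x j))"
    by (intro sums_unique has_sum_imp_sums has_sum_infsum nonneg_summable_on_complete) auto
  finally show ?thesis by (simp add: nn_integral_count_space_nat)
qed

lemma Z_scale:
  assumes "0 < x" "0 \<le> \<epsilon>" "\<epsilon> \<le> 1"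
  shows "Z a v (gamma_c a v) (\<epsilon> * x) \<le> ennreal \<epsilon> * Z a v (gamma_c a v) x"
proof -
  have "weight (\<epsilon> * x) j \<le> \<epsilon> * weight x j" for j
  proof (cases "j \<ge> 1")
    case True
    have "\<epsilon> ^ j \<le> \<epsilon> ^ 1" using assms True by (intro power_decreasing) auto
    hence "\<epsilon> ^ j * weight x j \<le> \<epsilon> * weight x j"
      using weight_nonneg[of x j] assms by (intro mult_right_mono) auto
    thus ?thesis using True by (simp add: weight_def power_mult_distrib mult_ac)
  qed (auto simp: weight_def)
  hence "(\<integral>\<^sup>+ j. ennreal (weight (\<epsilon> * x) j) \<partial>count_space UNIV)
      \<le> (\<integral>\<^sup>+ j. ennreal \<epsilon> * ennreal (weight x j) \<partial>count_space UNIV)"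
    using assms by (intro nn_integral_mono) (auto simp: ennreal_mult'[symmetric] intro!: ennreal_leI)
  thus ?thesis by (simp add: Z_eq_nn_integral nn_integral_cmult)
qed

lemma convex_on_power_nonneg: "convex_on {0::real..} (\<lambda>x. x ^ n)"
proof (cases "even n")
  case True
  thus ?thesis by (intro convex_on_subset[OF convex_power_even]) (auto intro: convex_real_interval)
next
  case False
  thus ?thesis by (rule convex_power_odd)
qed

lemma Z_convex:
  assumes "0 \<le> x" "0 \<le> y" "0 \<le> t" "t \<le> 1"
  shows "Z a v (gamma_c a v) ((1 - t) * x + t * y)
    \<le> ennreal (1 - t) * Z a v (gamma_c a v) x + ennreal t * Z a v (gamma_c a v) y"
proof -
  have "weight ((1 - t) * x + t * y) j \<le> (1 - t) * weight x j + t * weight y j" for j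
  proof (cases "j \<ge> 1")
    case True
    have "((1 - t) * x + t * y) ^ j \<le> (1 - t) * x ^ j + t * y ^ j"
      using convex_onD[OF convex_on_power_nonneg[of j], of t x y] assms by simp
    hence "(a j * exp (gamma_c a v * v j)) * ((1 - t) * x + t * y) ^ j
        \<le> (a j * exp (gamma_c a v * v j)) * ((1 - t) * x ^ j + t * y ^ j)"
      using a_pos[OF True] by (intro mult_left_mono) auto
    thus ?thesis using True by (simp add: weight_def algebra_simps)
  qed (auto simp: weight_def)
  hence "(\<integral>\<^sup>+ j. ennreal (weight ((1 - t) * x + t * y) j) \<partial>count_space UNIV)
      \<le> (\<integral>\<^sup>+ j. ennreal (1 - t) * ennreal (weight x j) + ennreal t * ennreal (weight y j) \<partial>count_space UNIV)"
    using assms weight_nonneg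
    by (intro nn_integral_mono) (auto simp: ennreal_mult'[symmetric] ennreal_plus[symmetric]
       simp del: ennreal_plus intro!: ennreal_leI)
  thus ?thesis by (simp add: Z_eq_nn_integral nn_integral_cmult nn_integral_add)
qed

lemma Z_eq_1_unique:
  assumes "0 < x" "x < y" "Z a v (gamma_c a v) x = 1" "Z a v (gamma_c a v) y = 1"
  shows False
proof -
  have "Z a v (gamma_c a v) (x / y * y) \<le> ennreal (x / y) * Z a v (gamma_c a v) y"
    using assms by (intro Z_scale) auto
  hence "1 \<le> ennreal (x / y)" using assms by simp
  hence "1 \<le> x / y" using assms by (simp add: ennreal_le_iff flip: ennreal_1)
  thus False using assms by simp
qed

text \<open>
  Let \<open>s\<close> be the supremum of \<open>{x. Z x \<le> 1}\<close>, which is nonempty by scaling and bounded through the first term of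
  the series. Partial sums are continuous, so \<open>Z s \<le> 1\<close>. If \<open>Z s < 1\<close>, then \<open>Z\<close> is finite at some point beyond
  \<open>s\<close>, because the domain is open, and convexity keeps \<open>Z \<le> 1\<close> a little beyond \<open>s\<close>.
\<close>

lemma Z_eq_1_exists: "\<exists>x>0. Z a v (gamma_c a v) x = 1"
proof -
  let ?Z = "Z a v (gamma_c a v)"
  define B where "B = {x. x > 0 \<and> ?Z x \<le> 1}"
  obtain x0 where x0: "x0 > 0" "?Z x0 < \<infinity>" using Z_domain_nonempty by auto
  then obtain z0 where z0: "z0 \<ge> 0" "?Z x0 = ennreal z0" by (cases "?Z x0") auto
  have B_ne: "1 / (z0 + 1) * x0 \<in> B"
  proof -
    have "?Z (1 / (z0 + 1) * x0) \<le> ennreal (1 / (z0 + 1)) * ennreal z0"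
      using Z_scale[of x0 "1 / (z0 + 1)"] x0 z0 by simp
    also have "\<dots> = ennreal (z0 / (z0 + 1))" using z0 by (simp add: ennreal_mult'[symmetric])
    also have "\<dots> \<le> 1" using z0 by (simp add: ennreal_le_1)
    finally show ?thesis using x0 z0 by (simp add: B_def)
  qed
  define c1 where "c1 = a 1 * exp (gamma_c a v * v 1)"
  have c1: "c1 > 0" using a_pos[of 1] by (simp add: c1_def)
  have B_le: "x \<le> 1 / c1" if "x \<in> B" for x
  proof -
    have "ennreal (weight x 1) \<le> (\<integral>\<^sup>+ j. ennreal (weight x j) \<partial>count_space UNIV)"
      by (intro nn_integral_ge_point) auto
    also have "\<dots> \<le> 1" using that by (simp add: B_def Z_eq_nn_integral)
    finally have "weight x 1 \<le> 1" by (simp add: ennreal_le_1)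
    thus ?thesis using c1 by (simp add: weight_def c1_def field_simps)
  qed
  have bdd: "bdd_above B" using B_le by (auto simp: bdd_above_def)
  define s where "s = Sup B"
  have s_ub: "x \<le> s" if "x \<in> B" for x using cSup_upper[OF that bdd] by (simp add: s_def)
  have s0: "s > 0" using s_ub[OF B_ne] B_ne by (auto simp: B_def intro: less_le_trans)
  have Zs: "?Z s \<le> 1"
  proof -
    have "(\<Sum>n<N. ennreal (weight s n)) \<le> 1" for N
    proof (rule ccontr)
      assume "\<not> ?thesis"
      moreover have "(\<Sum>n<N. ennreal (weight s n)) = ennreal (\<Sum>n<N. weight s n)"
        using s0 by (intro sum_ennreal weight_nonneg) auto
      ultimately have gt: "(\<Sum>n<N. weight s n) > 1" by (simp add: ennreal_le_1)
      have "isCont (\<lambda>x. \<Sum>n<N. weight x n) s"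
      proof (rule continuous_sum)
        fix n show "isCont (\<lambda>x. weight x n) s"
          by (cases "n \<ge> 1") (auto simp: weight_def intro!: continuous_intros)
      qed
      hence "\<forall>\<^sub>F x in at s. (\<Sum>n<N. weight x n) > 1"
        using gt by (intro order_tendstoD(1)) (auto simp: isCont_def)
      then obtain d where d: "d > 0" "\<And>x. x \<noteq> s \<Longrightarrow> dist x s < d \<Longrightarrow> (\<Sum>n<N. weight x n) > 1"
        by (auto simp: eventually_at)
      have "\<exists>x\<in>B. s - d < x"
        using less_cSup_iff[OF _ bdd, of "s - d"] B_ne d(1) by (auto simp: s_def[symmetric])
      then obtain x where x: "x \<in> B" "s - d < x" by blast
      have "(\<Sum>n<N. weight x n) > 1"
        using d(2)[of x] x s_ub[OF x(1)] gt by (cases "x = s") (auto simp: dist_real_def)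
      moreover have "ennreal (\<Sum>n<N. weight x n) \<le> 1"
      proof -
        have "ennreal (\<Sum>n<N. weight x n) = (\<Sum>n<N. ennreal (weight x n))"
          using x by (intro sum_ennreal[symmetric] weight_nonneg) (auto simp: B_def)
        also have "\<dots> \<le> (\<Sum>n. ennreal (weight x n))"
          by (intro sum_le_suminf) auto
        also have "\<dots> \<le> 1" using x by (simp add: B_def Z_eq_nn_integral nn_integral_count_space_nat)
        finally show ?thesis .
      qed
      ultimately show False by (simp add: ennreal_le_1)
    qed
    hence "(\<Sum>n. ennreal (weight s n)) \<le> 1" by (intro suminf_le_const) auto
    thus ?thesis by (simp add: Z_eq_nn_integral nn_integral_count_space_nat)
  qed
  have "\<not> ?Z s < 1"
  proof
    assume lt: "?Z s < 1"
    then obtain z where z: "z \<ge> 0" "?Z s = ennreal z" by (cases "?Z s") auto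
    have z1: "z < 1" using lt z by (simp add: ennreal_less_iff flip: ennreal_1)
    have "s \<in> {x. x > 0 \<and> ?Z x < \<infinity>}" using s0 z by simp
    then obtain e where e: "e > 0" "ball s e \<subseteq> {x. x > 0 \<and> ?Z x < \<infinity>}"
      using Z_domain_open open_contains_ball by blast
    define x1 where "x1 = s + e/2"
    have "x1 \<in> ball s e" using e by (simp add: x1_def dist_real_def)
    hence "?Z x1 < \<infinity>" using e by blast
    then obtain z' where z': "z' \<ge> 0" "?Z x1 = ennreal z'" by (cases "?Z x1") auto
    \<comment> \<open>small enough for the convex combination of the values \<open>z\<close> and \<open>z'\<close> to stay below 1\<close>
    define t where "t = (1 - z) / (z' + 1)"
    have t: "0 < t" "t \<le> 1" using z z' z1 by (auto simp: t_def)
    have "(1 - t) * z + t * z' \<le> z + t * (z' + 1)" using t z by (simp add: algebra_simps)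
    also have "\<dots> = 1" using z' by (simp add: t_def)
    finally have "ennreal ((1 - t) * z + t * z') \<le> 1" by (simp add: ennreal_le_1)
    hence "ennreal (1 - t) * ennreal z + ennreal t * ennreal z' \<le> 1"
      using t z z' by (simp add: ennreal_mult'[symmetric] ennreal_plus[symmetric] del: ennreal_plus)
    moreover have "?Z ((1 - t) * s + t * x1) \<le> ennreal (1 - t) * ?Z s + ennreal t * ?Z x1"
      using s0 e t by (intro Z_convex) (auto simp: x1_def)
    ultimately have "?Z ((1 - t) * s + t * x1) \<le> 1"
      unfolding z(2) z'(2) by (rule order_trans[rotated])
    moreover have "(1 - t) * s + t * x1 = s + t * (e/2)" by (simp add: x1_def algebra_simps)
    moreover have "t * (e/2) > 0" using t e by simp
    ultimately have "s + t * (e/2) \<in> B" using s0 by (simp add: B_def add_pos_pos)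
    thus False using s_ub[of "s + t * (e/2)"] \<open>t * (e/2) > 0\<close> by linarith
  qed
  hence "?Z s = 1" using Zs by (intro antisym) (simp_all add: not_less)
  thus ?thesis using s0 by blast
qed

lemma x_c: "x_c a v > 0" "Z a v (gamma_c a v) (x_c a v) = 1"
proof -
  have "\<exists>!x. x > 0 \<and> Z a v (gamma_c a v) x = 1"
    using Z_eq_1_exists Z_eq_1_unique by (metis not_less_iff_gr_or_eq)
  from theI'[OF this] show "x_c a v > 0" "Z a v (gamma_c a v) (x_c a v) = 1"
    by (auto simp: x_c_def)
qed

abbreviation q :: "nat pmf" where "q \<equiv> q_c a v"

lemma pmf_q: "pmf q j = weight (x_c a v) j"
proof -
  have "q = embed_pmf (weight (x_c a v))" unfolding q_c_def weight_def ..
  also have "pmf \<dots> j = weight (x_c a v) j"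
    using x_c weight_nonneg[of "x_c a v"] by (intro pmf_embed_pmf) (auto simp: Z_eq_nn_integral)
  finally show ?thesis .
qed

lemma pmf_q_pos: "j \<ge> 1 \<Longrightarrow> pmf q j > 0"
  using a_pos[of j] x_c by (simp add: pmf_q weight_def)

lemma set_pmf_q: "set_pmf q = {1..}"
proof -
  have "pmf q j \<noteq> 0 \<longleftrightarrow> j \<ge> 1" for j
  proof (cases "j \<ge> 1")
    case True
    with pmf_q_pos[of j] show ?thesis by simp
  next
    case False
    thus ?thesis by (simp add: pmf_q weight_def)
  qed
  thus ?thesis unfolding set_eq_iff set_pmf_iff atLeast_iff by blast
qed

text \<open>
  The series still converges at some \<open>x > x_c\<close>, by openness of its domain; take \<open>\<delta> = ln (x / x_c)\<close>.
\<close>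

lemma exp_moment: obtains \<delta> where "\<delta> > 0" "integrable q (\<lambda>j. exp (\<delta> * real j))"
proof -
  let ?Z = "Z a v (gamma_c a v)"
  have "x_c a v \<in> {x. x > 0 \<and> ?Z x < \<infinity>}" using x_c by simp
  then obtain e where e: "e > 0" "ball (x_c a v) e \<subseteq> {x. x > 0 \<and> ?Z x < \<infinity>}"
    using Z_domain_open open_contains_ball by blast
  define x1 where "x1 = x_c a v + e/2"
  have "x1 \<in> ball (x_c a v) e" using e by (simp add: x1_def dist_real_def)
  hence fin: "?Z x1 < \<infinity>" using e by blast
  have x1: "x1 > x_c a v" using e by (simp add: x1_def)
  define \<delta> where "\<delta> = ln (x1 / x_c a v)"
  have d: "\<delta> > 0" using x1 x_c by (simp add: \<delta>_def)
  have "pmf q j * exp (\<delta> * real j) = weight x1 j" for j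
  proof -
    have "exp (\<delta> * real j) = (x1 / x_c a v) ^ j"
      unfolding exp_of_nat2_mult using x1 x_c by (simp add: \<delta>_def)
    thus ?thesis using x_c by (simp add: pmf_q weight_def power_divide)
  qed
  hence "(\<integral>\<^sup>+ j. ennreal (exp (\<delta> * real j)) \<partial>q) = ?Z x1"
    by (simp add: nn_integral_measure_pmf Z_eq_nn_integral ennreal_mult'[symmetric])
  hence "integrable q (\<lambda>j. exp (\<delta> * real j))"
    using fin by (intro integrableI_nonneg) auto
  with d that show ?thesis by blast
qed

lemma integrable_of_eventually_le:
  assumes "integrable (measure_pmf p) g" "\<forall>\<^sub>F j in sequentially. \<bar>f j\<bar> \<le> g j" "\<And>j. g j \<ge> 0"
  shows "integrable (measure_pmf p) (f :: nat \<Rightarrow> real)"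
proof -
  obtain N where N: "\<And>j. j \<ge> N \<Longrightarrow> \<bar>f j\<bar> \<le> g j"
    using assms by (auto simp: eventually_sequentially)
  define K where "K = (\<Sum>j<N. \<bar>f j\<bar>)"
  have K: "\<bar>f j\<bar> \<le> K" if "j < N" for j
    unfolding K_def using that by (intro member_le_sum) auto
  have K0: "K \<ge> 0" by (auto simp: K_def sum_nonneg)
  show ?thesis
  proof (rule Bochner_Integration.integrable_bound)
    show "integrable (measure_pmf p) (\<lambda>j. K + g j)" using assms by auto
    show "AE j in measure_pmf p. norm (f j) \<le> norm (K + g j)"
    proof (rule AE_I2)
      fix j show "norm (f j) \<le> norm (K + g j)"
        using N[of j] K[of j] K0 assms(3)[of j] by (cases "j < N") auto
    qed
  qed auto
qed

definition mean :: real where "mean = measure_pmf.expectation q real"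

lemma integrable_real: "integrable q real"
proof -
  obtain \<delta> where d: "\<delta> > 0" "integrable q (\<lambda>j. exp (\<delta> * real j))" by (rule exp_moment)
  have "\<forall>\<^sub>F j in sequentially. \<bar>real j\<bar> \<le> exp (\<delta> * real j)" using d(1) by real_asymp
  from integrable_of_eventually_le[OF d(2) this] show ?thesis by simp
qed

lemma integrable_real_square: "integrable q (\<lambda>j. (real j)\<^sup>2)"
proof -
  obtain \<delta> where d: "\<delta> > 0" "integrable q (\<lambda>j. exp (\<delta> * real j))" by (rule exp_moment)
  have "\<forall>\<^sub>F j in sequentially. \<bar>(real j)\<^sup>2\<bar> \<le> exp (\<delta> * real j)" using d(1) by real_asymp
  from integrable_of_eventually_le[OF d(2) this] show ?thesis by simp
qed

lemma integrable_v_square: "integrable q (\<lambda>j. (v j)\<^sup>2)"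
proof -
  obtain \<delta> where d: "\<delta> > 0" "integrable q (\<lambda>j. exp (\<delta> * real j))" by (rule exp_moment)
  obtain C where C: "C > 0" "\<And>j. j \<ge> 1 \<Longrightarrow> v j \<le> C * (real j)\<^sup>2" 
    using v_le_quadratic by blast
  have "\<forall>\<^sub>F j in sequentially. (C * (real j)\<^sup>2)\<^sup>2 \<le> exp (\<delta> * real j)" using d(1) C(1) by real_asymp
  hence "\<forall>\<^sub>F j in sequentially. \<bar>(v j)\<^sup>2\<bar> \<le> exp (\<delta> * real j)"
    using eventually_ge_at_top[of 1] v_eventually_ge_linear[of 0]
  proof eventually_elim
    case (elim j)
    have "(v j)\<^sup>2 \<le> (C * (real j)\<^sup>2)\<^sup>2" using elim C(2)[of j] by (intro power_mono) auto
    thus ?case using elim by simp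
  qed
  from integrable_of_eventually_le[OF d(2) this] show ?thesis by simp
qed

lemma integrable_v: "integrable q v"
  by (rule measure_pmf.square_integrable_imp_integrable[OF _ integrable_v_square]) simp

lemma mean_ge_1: "mean \<ge> 1"
proof -
  have "measure_pmf.expectation q (\<lambda>_. 1) \<le> mean"
    unfolding mean_def using set_pmf_q
    by (intro integral_mono_AE integrable_real) (auto simp: AE_measure_pmf_iff)
  thus ?thesis by simp
qed

lemma alpha_c_eq: "alpha_c a v = 1 / mean"
  by (simp add: alpha_c_def mean_def)

lemma expectation_v: "measure_pmf.expectation q v = rho_c a v * mean"
  using mean_ge_1 by (simp add: rho_c_def mean_def)

lemma pmf_q_exp_tail: obtains \<delta> K where "\<delta> > 0" "K > 0" "\<And>j. pmf q j \<le> K * exp (- \<delta> * real j)"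
proof -
  obtain \<delta> where d: "\<delta> > 0" "integrable q (\<lambda>j. exp (\<delta> * real j))" by (rule exp_moment)
  define K where "K = measure_pmf.expectation q (\<lambda>j. exp (\<delta> * real j))"
  have le: "pmf q j \<le> K * exp (- \<delta> * real j)" for j
  proof -
    have "measure_pmf.expectation q (\<lambda>i. exp (\<delta> * real i) * indicator {j} i) \<le> K"
      unfolding K_def
      by (intro integral_mono integrable_real_mult_indicator d(2)) (auto simp: indicator_def)
    also have "(\<lambda>i. exp (\<delta> * real i) * indicator {j} i) = (\<lambda>i. exp (\<delta> * real j) * indicator {j} i)"
      by (auto simp: indicator_def)
    also have "measure_pmf.expectation q \<dots> = pmf q j * exp (\<delta> * real j)"
      by (simp add: measure_pmf_single)
    finally show ?thesis by (simp add: exp_minus field_simps)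
  qed
  have "0 < K * exp (- \<delta> * real 1)" using le[of 1] pmf_q_pos[of 1] by linarith
  hence "K > 0" by (simp add: zero_less_mult_iff)
  with le d that show ?thesis by blast
qed

lemma ln_pmf_q: "j \<ge> 1 \<Longrightarrow>
    - ln (pmf q j) = - ln (a j) - real j * ln (x_c a v) - gamma_c a v * v j"
  using a_pos[of j] x_c by (simp add: pmf_q weight_def ln_mult ln_realpow)

text \<open>
  In \<open>- ln q(j)\<close> the terms of order \<open>v j\<close> cancel by the definition of \<open>\<gamma>\<^sub>c\<close>, and \<open>v\<close> dominates the linear term.
\<close>

lemma ln_pmf_q_small: "(\<lambda>j. - ln (pmf q j) / v j) \<longlonglongrightarrow> 0"
proof -
  have g: "(\<lambda>j. - ln (a j) / v j) \<longlonglongrightarrow> gamma_c a v"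
    using gamma_c_exists by (simp add: gamma_c_def convergent_LIMSEQ_iff)
  have "(\<lambda>j. inverse (v j / real j)) \<longlonglongrightarrow> 0"
    by (rule tendsto_inverse_0_at_top[OF v_superlinear])
  hence "(\<lambda>j. - ln (a j) / v j - inverse (v j / real j) * ln (x_c a v) - gamma_c a v)
     \<longlonglongrightarrow> gamma_c a v - 0 * ln (x_c a v) - gamma_c a v"
    by (intro tendsto_intros g)
  moreover have "\<forall>\<^sub>F j in sequentially. - ln (a j) / v j - inverse (v j / real j) * ln (x_c a v) - gamma_c a v
      = - ln (pmf q j) / v j"
    using eventually_ge_at_top[of 1] v_eventually_ge_linear[of 1]
  proof eventually_elim
    case (elim j)
    hence "v j > 0" by linarith
    thus ?case using elim by (simp add: ln_pmf_q field_simps)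
  qed
  ultimately show ?thesis by (simp add: Lim_transform_eventually)
qed

lemma ln_pmf_q_le: obtains C where "C \<ge> 0" "\<And>j. j \<ge> 1 \<Longrightarrow> - ln (pmf q j) \<le> v j + C * real j"
proof -
  have "\<forall>\<^sub>F j in sequentially. - ln (pmf q j) / v j < 1"
    using ln_pmf_q_small by (rule order_tendstoD) simp
  hence "\<forall>\<^sub>F j in sequentially. - ln (pmf q j) \<le> v j"
    using eventually_ge_at_top[of 1] v_eventually_ge_linear[of 1]
  proof eventually_elim
    case (elim j)
    hence "v j > 0" by linarith
    thus ?case using elim by (simp add: field_simps)
  qed
  then obtain N where N: "\<And>j. j \<ge> N \<Longrightarrow> - ln (pmf q j) \<le> v j"
    by (auto simp: eventually_sequentially)
  define C where "C = (\<Sum>j<N. \<bar>- ln (pmf q j) - v j\<bar>)"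
  have C0: "C \<ge> 0" by (auto simp: C_def sum_nonneg)
  have "- ln (pmf q j) \<le> v j + C * real j" if j: "j \<ge> 1" for j
  proof (cases "j < N")
    case True
    hence "\<bar>- ln (pmf q j) - v j\<bar> \<le> C" unfolding C_def
      by (intro member_le_sum) auto
    moreover have "C * 1 \<le> C * real j" using j C0 by (intro mult_left_mono) auto
    ultimately show ?thesis by linarith
  next
    case False
    thus ?thesis using N[of j] mult_nonneg_nonneg[OF C0, of "real j"] by simp
  qed
  with C0 that show ?thesis by blast
qed

text \<open>
  \<open>\<rho>\<^sub>c\<close> is an average of the ratios \<open>v j / j\<close> with positive weights proportional to \<open>j q(j)\<close>, and these ratios are not constant since they
  tend to infinity.
\<close>

lemma ratios_around_rho_c:
  obtains j1 j2 where "j1 \<ge> 1" "j2 \<ge> 1" "v j1 / real j1 < rho_c a v" "rho_c a v < v j2 / real j2"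
proof -
  have "\<forall>\<^sub>F j in sequentially. rho_c a v < v j / real j"
    using v_eventually_ge_linear[of "rho_c a v + 1"] eventually_ge_at_top[of 1]
    by eventually_elim (auto simp: field_simps)
  then obtain N where N: "\<And>j. j \<ge> N \<Longrightarrow> rho_c a v < v j / real j"
    by (auto simp: eventually_sequentially)
  have "\<exists>j1\<ge>1. v j1 / real j1 < rho_c a v"
  proof (rule ccontr)
    assume neg: "\<not> ?thesis"
    have ge: "v j \<ge> rho_c a v * real j" if "j \<ge> 1" for j
    proof -
      have "rho_c a v \<le> v j / real j" using neg that by (meson not_less)
      thus ?thesis using that by (simp add: pos_le_divide_eq)
    qed
    have int: "integrable q (\<lambda>j. v j - rho_c a v * real j)"
      using integrable_v integrable_real by auto
    have "measure_pmf.expectation q (\<lambda>j. v j - rho_c a v * real j) = 0"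
      using integrable_v integrable_real expectation_v by (simp add: mean_def)
    hence "AE j in q. v j - rho_c a v * real j = 0"
      using int ge set_pmf_q
      by (subst (asm) integral_nonneg_eq_0_iff_AE) (auto simp: AE_measure_pmf_iff)
    hence "v (N+1) = rho_c a v * real (N+1)" using set_pmf_q by (auto simp: AE_measure_pmf_iff)
    thus False using N[of "N+1"] by simp
  qed
  then obtain j1 where "j1 \<ge> 1" "v j1 / real j1 < rho_c a v" by blast
  thus ?thesis using N[of "N+1"] by (intro that[of j1 "N+1"]) auto
qed

end

section \<open>Independent samples, exponential moments and change of measure\<close>

lemma replicate_pmf_Suc_map:
  "replicate_pmf (Suc n) p = map_pmf (\<lambda>(x, xs). x # xs) (pair_pmf p (replicate_pmf n p))"
  by (simp add: map_pmf_def pair_pmf_def bind_assoc_pmf bind_return_pmf)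

lemma pmf_replicate_pmf:
  "length xs = n \<Longrightarrow> pmf (replicate_pmf n p) xs = prod_list (map (pmf p) xs)"
proof (induction n arbitrary: xs)
  case (Suc n)
  then obtain x ys where xs: "xs = x # ys" "length ys = n" by (auto simp: length_Suc_conv)
  have "inj (\<lambda>(x, xs). x # xs :: 'a list)" by (auto simp: inj_def)
  hence "pmf (map_pmf (\<lambda>(x, xs). x # xs) (pair_pmf p (replicate_pmf n p))) ((\<lambda>(x, xs). x # xs) (x, ys))
      = pmf (pair_pmf p (replicate_pmf n p)) (x, ys)"
    by (rule pmf_map_inj')
  thus ?case unfolding replicate_pmf_Suc_map using Suc.IH[OF xs(2)] xs by (simp add: pmf_pair)
qed simp

lemma length_replicate_pmf: "xs \<in> set_pmf (replicate_pmf n p) \<Longrightarrow> length xs = n"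
  by (auto simp: set_replicate_pmf)

text \<open>
  Integrating over one coordinate with the others held fixed kills the cross term, so only integrals in a single
  variable of functions with a sign occur.
\<close>

lemma nn_integral_replicate_sum_square:
  fixes g :: "'a \<Rightarrow> real"
  assumes sq: "integrable (measure_pmf p) (\<lambda>x. (g x)\<^sup>2)" and mean0: "measure_pmf.expectation p g = 0"
  shows "(\<integral>\<^sup>+ xs. ennreal ((sum_list (map g xs))\<^sup>2) \<partial>replicate_pmf n p)
    = ennreal (real n * measure_pmf.expectation p (\<lambda>x. (g x)\<^sup>2))"
proof (induction n)
  case (Suc n)
  let ?V = "measure_pmf.expectation p (\<lambda>x. (g x)\<^sup>2)"
  have int: "integrable (measure_pmf p) g"
    by (rule measure_pmf.square_integrable_imp_integrable[OF _ sq]) simp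
  have V0: "?V \<ge> 0" by simp
  have step: "(\<integral>\<^sup>+ x. ennreal ((g x + T)\<^sup>2) \<partial>p) = ennreal ?V + ennreal (T\<^sup>2)" for T :: real
  proof -
    have eq: "(g x + T)\<^sup>2 = (g x)\<^sup>2 + 2 * T * g x + T\<^sup>2" for x by (simp add: power2_eq_square algebra_simps)
    have "(\<integral>\<^sup>+ x. ennreal ((g x + T)\<^sup>2) \<partial>p) = ennreal (measure_pmf.expectation p (\<lambda>x. (g x + T)\<^sup>2))"
    proof (rule nn_integral_eq_integral)
      show "integrable (measure_pmf p) (\<lambda>x. (g x + T)\<^sup>2)" unfolding eq using sq int by auto
    qed auto
    also have "measure_pmf.expectation p (\<lambda>x. (g x + T)\<^sup>2) = ?V + T\<^sup>2"
      unfolding eq using sq int mean0 by simp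
    finally show ?thesis using V0 by (simp add: ennreal_plus)
  qed
  have "replicate_pmf (Suc n) p = replicate_pmf n p \<bind> (\<lambda>xs. p \<bind> (\<lambda>x. return_pmf (x # xs)))"
    unfolding replicate_pmf.simps by (rule bind_commute_pmf)
  hence "(\<integral>\<^sup>+ xs. ennreal ((sum_list (map g xs))\<^sup>2) \<partial>replicate_pmf (Suc n) p)
      = (\<integral>\<^sup>+ xs. \<integral>\<^sup>+ x. ennreal ((g x + sum_list (map g xs))\<^sup>2) \<partial>p \<partial>replicate_pmf n p)"
    by simp
  also have "\<dots> = ennreal ?V + ennreal (real n * ?V)"
    unfolding step by (simp add: nn_integral_add Suc.IH)
  also have "\<dots> = ennreal (real (Suc n) * ?V)"
    using V0 by (subst ennreal_plus[symmetric]) (auto simp: algebra_simps)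
  finally show ?case .
qed simp

lemma chebyshev_replicate_pmf:
  fixes g :: "'a \<Rightarrow> real"
  assumes sq: "integrable (measure_pmf p) (\<lambda>x. (g x)\<^sup>2)" and mean0: "measure_pmf.expectation p g = 0"
    and t: "t > 0"
  shows "measure_pmf.prob (replicate_pmf n p) {xs. t \<le> \<bar>sum_list (map g xs)\<bar>}
    \<le> real n * measure_pmf.expectation p (\<lambda>x. (g x)\<^sup>2) / t\<^sup>2"
proof -
  let ?M = "measure_pmf (replicate_pmf n p)"
  let ?u = "\<lambda>xs. ennreal ((sum_list (map g xs))\<^sup>2)"
  let ?V = "real n * measure_pmf.expectation p (\<lambda>x. (g x)\<^sup>2)"
  have V: "?V \<ge> 0" by simp
  have sub: "{xs. t \<le> \<bar>sum_list (map g xs)\<bar>} \<subseteq> {xs. 1 \<le> ennreal (1 / t\<^sup>2) * ?u xs}"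
  proof safe
    fix xs assume "t \<le> \<bar>sum_list (map g xs)\<bar>"
    hence "t\<^sup>2 \<le> (sum_list (map g xs))\<^sup>2" using t by (metis abs_le_square_iff abs_of_pos)
    hence "1 \<le> 1 / t\<^sup>2 * (sum_list (map g xs))\<^sup>2" using t by (simp add: field_simps)
    thus "1 \<le> ennreal (1 / t\<^sup>2) * ?u xs"
      by (subst ennreal_mult[symmetric]) (auto simp: ennreal_leI simp flip: ennreal_1)
  qed
  have "emeasure ?M {xs. t \<le> \<bar>sum_list (map g xs)\<bar>} \<le> emeasure ?M {xs. 1 \<le> ennreal (1 / t\<^sup>2) * ?u xs}"
    using sub by (intro emeasure_mono) auto
  also have "\<dots> \<le> ennreal (1 / t\<^sup>2) * (\<integral>\<^sup>+ xs. ?u xs \<partial>?M)"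
    using nn_integral_Markov_inequality[of ?u UNIV ?M "ennreal (1 / t\<^sup>2)"] by simp
  also have "\<dots> = ennreal (1 / t\<^sup>2) * ennreal ?V"
    by (simp only: nn_integral_replicate_sum_square[OF sq mean0])
  also have "\<dots> = ennreal (?V / t\<^sup>2)" using V by (subst ennreal_mult[symmetric]) auto
  finally show ?thesis using V by (simp add: measure_pmf.emeasure_eq_measure)
qed

text \<open>
  Disjoint blocks of an independent sample are independent and identically distributed.
\<close>

lemma nn_integral_replicate_blocks:
  fixes F :: "'a list \<Rightarrow> ennreal"
  assumes "b * r \<le> k"
  shows "(\<integral>\<^sup>+ xs. (\<Prod>i<b. F (take r (drop (i * r) xs))) \<partial>replicate_pmf k p)
    = (\<integral>\<^sup>+ xs. F xs \<partial>replicate_pmf r p) ^ b"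
  using assms
proof (induction b arbitrary: k)
  case (Suc b)
  have k: "k = r + (k - r)" "b * r \<le> k - r" using Suc.prems by auto
  have "(\<integral>\<^sup>+ xs. (\<Prod>i<Suc b. F (take r (drop (i * r) xs))) \<partial>replicate_pmf k p)
      = (\<integral>\<^sup>+ xs. \<integral>\<^sup>+ ys. (\<Prod>i<Suc b. F (take r (drop (i * r) (xs @ ys)))) \<partial>replicate_pmf (k - r) p \<partial>replicate_pmf r p)"
    by (subst k(1), subst replicate_pmf_distrib) simp
  also have "\<dots> = (\<integral>\<^sup>+ xs. \<integral>\<^sup>+ ys. F xs * (\<Prod>i<b. F (take r (drop (i * r) ys))) \<partial>replicate_pmf (k - r) p \<partial>replicate_pmf r p)"
  proof (intro nn_integral_cong_AE, subst AE_measure_pmf_iff, intro ballI nn_integral_cong)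
    fix xs ys assume "xs \<in> set_pmf (replicate_pmf r p)"
    hence len: "length xs = r" by (rule length_replicate_pmf)
    have "take r (drop (Suc i * r) (xs @ ys)) = take r (drop (i * r) ys)" for i
      using len by simp
    thus "(\<Prod>i<Suc b. F (take r (drop (i * r) (xs @ ys)))) = F xs * (\<Prod>i<b. F (take r (drop (i * r) ys)))"
      using len by (simp only: prod.lessThan_Suc_shift) simp
  qed
  also have "\<dots> = (\<integral>\<^sup>+ xs. F xs \<partial>replicate_pmf r p) ^ Suc b"
    by (simp add: nn_integral_cmult nn_integral_multc Suc.IH[OF k(2)])
  finally show ?case .
qed simp

lemma exp_le_quadratic: "exp x \<le> 1 + x + x\<^sup>2 * exp \<bar>x\<bar>" for x :: real
proof -
  obtain t where t: "\<bar>t\<bar> \<le> \<bar>x\<bar>" "exp x = (\<Sum>m<2. (x ^ m) / fact m) + (exp t / fact 2) * x ^ 2"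
    using Maclaurin_exp_le by blast
  have "exp t / 2 \<le> exp \<bar>x\<bar>"
  proof -
    have "exp t \<le> exp \<bar>x\<bar>" using t(1) by simp
    thus ?thesis using exp_gt_zero[of t] by linarith
  qed
  hence "exp t / 2 * x\<^sup>2 \<le> exp \<bar>x\<bar> * x\<^sup>2" by (intro mult_right_mono) auto
  thus ?thesis using t(2) by (simp add: numeral_2_eq_2 mult.commute)
qed

text \<open>
  Expand \<open>exp\<close> to second order: the linear term has mean 0, and the exponential moment bounds the remainder.
\<close>

lemma nn_integral_exp_le_gaussian:
  fixes g :: "'a \<Rightarrow> real"
  assumes int: "integrable (measure_pmf p) g" and mean0: "measure_pmf.expectation p g = 0"
    and int2: "integrable (measure_pmf p) (\<lambda>x. (g x)\<^sup>2 * exp (\<tau> * \<bar>g x\<bar>))"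
    and C: "measure_pmf.expectation p (\<lambda>x. (g x)\<^sup>2 * exp (\<tau> * \<bar>g x\<bar>)) \<le> C"
    and th: "\<bar>\<theta>\<bar> \<le> \<tau>"
  shows "(\<integral>\<^sup>+ x. ennreal (exp (\<theta> * g x)) \<partial>p) \<le> ennreal (exp (C * \<theta>\<^sup>2))"
proof -
  let ?R = "\<lambda>x. 1 + \<theta> * g x + \<theta>\<^sup>2 * ((g x)\<^sup>2 * exp (\<tau> * \<bar>g x\<bar>))"
  have le: "exp (\<theta> * g x) \<le> ?R x" for x
  proof -
    have "exp \<bar>\<theta> * g x\<bar> \<le> exp (\<tau> * \<bar>g x\<bar>)" using th by (simp add: abs_mult mult_right_mono)
    hence "(\<theta> * g x)\<^sup>2 * exp \<bar>\<theta> * g x\<bar> \<le> (\<theta> * g x)\<^sup>2 * exp (\<tau> * \<bar>g x\<bar>)"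
      by (intro mult_left_mono) auto
    thus ?thesis using exp_le_quadratic[of "\<theta> * g x"] by (simp add: power_mult_distrib mult.assoc)
  qed
  have "(\<integral>\<^sup>+ x. ennreal (exp (\<theta> * g x)) \<partial>p) \<le> (\<integral>\<^sup>+ x. ennreal (?R x) \<partial>p)"
    by (intro nn_integral_mono ennreal_leI le)
  also have "\<dots> = ennreal (measure_pmf.expectation p ?R)"
    using int int2 le by (intro nn_integral_eq_integral) (auto intro: order_trans[OF less_imp_le[OF exp_gt_zero]])
  also have "measure_pmf.expectation p ?R
      = 1 + \<theta>\<^sup>2 * measure_pmf.expectation p (\<lambda>x. (g x)\<^sup>2 * exp (\<tau> * \<bar>g x\<bar>))"
    using int int2 mean0 by simp
  also have "\<dots> \<le> 1 + C * \<theta>\<^sup>2" using mult_left_mono[OF C, of "\<theta>\<^sup>2"] by (simp add: mult.commute)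
  also have "\<dots> \<le> exp (C * \<theta>\<^sup>2)" by (rule exp_ge_add_one_self)
  finally show ?thesis by (simp add: ennreal_leI)
qed

text \<open>
  Since \<open>exp \<bar>y\<bar> \<le> exp y + exp (- y)\<close>, the exponential moment of \<open>\<theta> \<bar>X\<bar>\<close> under \<open>\<mu>\<close> is at most \<open>2 K exp B\<close>. By
  Jensen's inequality this bounds the mean. The price \<open>ln K\<close> of changing the law enters additively.
\<close>

lemma expectation_abs_le_of_dominated:
  fixes X :: "'a \<Rightarrow> real"
  assumes fin: "finite (set_pmf \<mu>)" and dom: "\<And>x. pmf \<mu> x \<le> K * pmf \<nu> x" and K: "K > 0" and th: "\<theta> > 0"
    and up: "(\<integral>\<^sup>+ x. ennreal (exp (\<theta> * X x)) \<partial>\<nu>) \<le> ennreal (exp B)"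
    and dn: "(\<integral>\<^sup>+ x. ennreal (exp (- \<theta> * X x)) \<partial>\<nu>) \<le> ennreal (exp B)"
  shows "measure_pmf.expectation \<mu> (\<lambda>x. \<bar>X x\<bar>) \<le> (ln 2 + ln K + B) / \<theta>"
proof -
  have int: "integrable (measure_pmf \<mu>) f" for f :: "'a \<Rightarrow> real"
    using fin by (rule integrable_measure_pmf_finite)
  let ?f = "\<lambda>x. exp (\<theta> * X x) + exp (- \<theta> * X x)"
  have "(\<integral>\<^sup>+ x. ennreal (?f x) \<partial>\<mu>) \<le> ennreal K * (\<integral>\<^sup>+ x. ennreal (?f x) \<partial>\<nu>)"
  proof -
    have "(\<integral>\<^sup>+ x. ennreal (?f x) \<partial>\<mu>) = (\<integral>\<^sup>+ x. ennreal (pmf \<mu> x) * ennreal (?f x) \<partial>count_space UNIV)"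
      by (simp only: nn_integral_measure_pmf)
    also have "\<dots> \<le> (\<integral>\<^sup>+ x. ennreal K * (ennreal (pmf \<nu> x) * ennreal (?f x)) \<partial>count_space UNIV)"
      using dom K by (intro nn_integral_mono)
        (simp add: ennreal_mult[symmetric] ennreal_leI mult_right_mono mult.assoc[symmetric] del: ennreal_plus)
    also have "\<dots> = ennreal K * (\<integral>\<^sup>+ x. ennreal (?f x) \<partial>\<nu>)"
      by (simp only: nn_integral_measure_pmf) (simp add: nn_integral_cmult)
    finally show ?thesis .
  qed
  also have "(\<integral>\<^sup>+ x. ennreal (?f x) \<partial>\<nu>)
      = (\<integral>\<^sup>+ x. ennreal (exp (\<theta> * X x)) \<partial>\<nu>) + (\<integral>\<^sup>+ x. ennreal (exp (- \<theta> * X x)) \<partial>\<nu>)"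
    by (subst nn_integral_add[symmetric]) auto
  also have "\<dots> \<le> ennreal (exp B) + ennreal (exp B)" by (intro add_mono up dn)
  also have "ennreal K * (ennreal (exp B) + ennreal (exp B)) = ennreal (2 * K * exp B)"
    using K by (simp add: ennreal_mult[symmetric] ennreal_plus[symmetric] del: ennreal_plus)
  finally have "(\<integral>\<^sup>+ x. ennreal (?f x) \<partial>\<mu>) \<le> ennreal (2 * K * exp B)"
    by (simp add: mult_left_mono)
  moreover have "(\<integral>\<^sup>+ x. ennreal (?f x) \<partial>\<mu>) = ennreal (measure_pmf.expectation \<mu> ?f)"
    by (intro nn_integral_eq_integral int) (auto intro: add_nonneg_nonneg)
  ultimately have Ef: "measure_pmf.expectation \<mu> ?f \<le> 2 * K * exp B"
    using K by (simp add: ennreal_le_iff)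
  define m where "m = measure_pmf.expectation \<mu> (\<lambda>x. \<bar>X x\<bar>)"
  have "exp (\<theta> * m) = measure_pmf.expectation \<mu> (\<lambda>x. exp (\<theta> * m) * (1 + (\<theta> * \<bar>X x\<bar> - \<theta> * m)))"
    by (simp add: int m_def)
  also have "\<dots> \<le> measure_pmf.expectation \<mu> ?f"
  proof (intro integral_mono int)
    fix x
    have "exp (\<theta> * m) * (1 + (\<theta> * \<bar>X x\<bar> - \<theta> * m)) \<le> exp (\<theta> * m) * exp (\<theta> * \<bar>X x\<bar> - \<theta> * m)"
      by (intro mult_left_mono exp_ge_add_one_self) auto
    also have "\<dots> = exp (\<theta> * \<bar>X x\<bar>)" by (simp flip: exp_add)
    also have "\<dots> \<le> ?f x" by (cases "X x \<ge> 0") (auto simp: less_imp_le)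
    finally show "exp (\<theta> * m) * (1 + (\<theta> * \<bar>X x\<bar> - \<theta> * m)) \<le> ?f x" .
  qed
  finally have "exp (\<theta> * m) \<le> 2 * K * exp B" using Ef by linarith
  hence "\<theta> * m \<le> ln (2 * K * exp B)" using K by (subst ln_ge_iff) auto
  also have "\<dots> = ln 2 + ln K + B" using K by (simp add: ln_mult)
  finally show ?thesis using th by (simp add: m_def field_simps)
qed

text \<open>
  The sign of the difference of the mass functions is the extremal test function.
\<close>

lemma d_TV_eq_expectation_diff:
  fixes p p' :: "'a pmf"
  defines "s \<equiv> \<lambda>z. sgn (pmf p z - pmf p' z)"
  shows "d_TV p p' = 1/2 * (measure_pmf.expectation p s - measure_pmf.expectation p' s)"
proof -
  have abs: "Infinite_Set_Sum.abs_summable_on (\<lambda>z. pmf P z * s z) UNIV" for P :: "'a pmf"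
  proof -
    have "Infinite_Set_Sum.abs_summable_on (pmf P) UNIV" by (rule pmf_abs_summable)
    thus ?thesis
      by (rule abs_summable_on_comparison_test)
        (auto simp: s_def abs_mult sgn_if)
  qed
  have "measure_pmf.expectation p s - measure_pmf.expectation p' s
      = infsetsum (\<lambda>z. pmf p z * s z - pmf p' z * s z) UNIV"
    unfolding pmf_expectation_eq_infsetsum by (rule infsetsum_diff[symmetric]) (rule abs)+
  also have "(\<lambda>z. pmf p z * s z - pmf p' z * s z) = (\<lambda>z. \<bar>pmf p z - pmf p' z\<bar>)"
    by (auto simp: s_def sgn_if abs_if)
  finally have eq: "measure_pmf.expectation p s - measure_pmf.expectation p' s
      = infsetsum (\<lambda>z. \<bar>pmf p z - pmf p' z\<bar>) UNIV" .
  have "Infinite_Set_Sum.abs_summable_on (pmf P) UNIV" for P :: "'a pmf" by (rule pmf_abs_summable)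
  hence "Infinite_Set_Sum.abs_summable_on (\<lambda>z. \<bar>pmf p z - pmf p' z\<bar>) UNIV"
    unfolding abs_summable_on_def by (intro integrable_abs Bochner_Integration.integrable_diff)
  hence "infsetsum (\<lambda>z. \<bar>pmf p z - pmf p' z\<bar>) UNIV = (\<Sum>\<^sub>\<infinity>z. \<bar>pmf p z - pmf p' z\<bar>)"
    by (rule infsetsum_infsum)
  thus ?thesis by (simp add: d_TV_def eq)
qed

section \<open>The microcanonical law as a conditioned product law\<close>

lemma prod_list_map_eq_prod:
  "(\<Prod>i<length xs. f (xs ! i)) = prod_list (map f xs)" for f :: "'a \<Rightarrow> 'b::comm_monoid_mult"
  by (induction xs) (simp_all add: prod.lessThan_Suc_shift del: prod.lessThan_Suc)

lemma sum_list_map_rotate: "sum_list (map f (rotate i xs)) = sum_list (map f xs)"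
  for f :: "'a \<Rightarrow> 'b::comm_monoid_add"
proof (induction i)
  case (Suc i)
  have "sum_list (map f (rotate1 ys)) = sum_list (map f ys)" for ys
    by (cases ys) (simp_all add: add.commute)
  thus ?case using Suc by simp
qed simp

lemma prod_list_map_rotate: "prod_list (map f (rotate i xs)) = prod_list (map f xs)"
  for f :: "'a \<Rightarrow> 'b::comm_monoid_mult"
proof (induction i)
  case (Suc i)
  have "prod_list (map f (rotate1 ys)) = prod_list (map f ys)" for ys
    by (cases ys) (simp_all add: mult.commute)
  thus ?case using Suc by simp
qed simp

context profile
begin

lemma mem_constraint_set:
  "js \<in> constraint_set v \<rho> n k \<longleftrightarrow> length js = k \<and> (\<forall>j\<in>set js. j \<ge> 1) \<and> sum_list js = n
     \<and> \<bar>sum_list (map v js) - \<rho> * real n\<bar> \<le> 1"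
  by (auto simp: constraint_set_def sum_list_sum_nth atLeast0LessThan)

lemma finite_constraint_set: "finite (constraint_set v \<rho> n k)"
proof (rule finite_subset)
  show "constraint_set v \<rho> n k \<subseteq> {js. set js \<subseteq> {..n} \<and> length js = k}"
    by (auto simp: mem_constraint_set member_le_sum_list)
qed (auto intro: finite_lists_length_eq)

lemma W_eq: "W a v \<rho> n k = (\<Sum>js\<in>constraint_set v \<rho> n k. prod_list (map a js))"
  unfolding W_def by (intro sum.cong) (auto simp: mem_constraint_set simp flip: prod_list_map_eq_prod)

lemma prod_list_q: "\<forall>j\<in>set js. j \<ge> 1 \<Longrightarrow> prod_list (map (pmf q) js)
    = prod_list (map a js) * x_c a v ^ sum_list js * exp (gamma_c a v * sum_list (map v js))"
  by (induction js) (auto simp: pmf_q weight_def power_add exp_add algebra_simps)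

lemma prod_list_a_pos: "\<forall>j\<in>set js. j \<ge> 1 \<Longrightarrow> prod_list (map a js) > 0"
  by (induction js) (auto simp: a_pos)

definition hit_prob :: "real \<Rightarrow> nat \<Rightarrow> nat \<Rightarrow> real"
  where "hit_prob \<rho> n k = measure_pmf.prob (replicate_pmf k q) (constraint_set v \<rho> n k)"

text \<open>
  The ratio of \<open>\<Prod> q j_i\<close> to \<open>\<Prod> a j_i\<close> on a tuple with \<open>\<Sum> j_i = n\<close> and \<open>\<Sum> v j_i = \<rho> n\<close> exactly.
\<close>

definition tilt :: "real \<Rightarrow> nat \<Rightarrow> real"
  where "tilt \<rho> n = x_c a v ^ n * exp (gamma_c a v * \<rho> * real n)"

lemma tilt_pos: "tilt \<rho> n > 0"
  using x_c by (simp add: tilt_def)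

lemma hit_prob_eq: "hit_prob \<rho> n k = (\<Sum>js\<in>constraint_set v \<rho> n k. prod_list (map (pmf q) js))"
  unfolding hit_prob_def measure_measure_pmf_finite[OF finite_constraint_set]
  by (intro sum.cong) (auto simp: mem_constraint_set pmf_replicate_pmf)

text \<open>
  The correction to \<open>tilt\<close> for a \<open>v\<close>-total that differs from \<open>\<rho> n\<close> by at most 1.
\<close>

abbreviation window_factor :: real where "window_factor \<equiv> exp \<bar>gamma_c a v\<bar>"

lemma prod_list_q_bounds:
  assumes "js \<in> constraint_set v \<rho> n k"
  shows "prod_list (map (pmf q) js) \<le> tilt \<rho> n * window_factor * prod_list (map a js)"
    and "tilt \<rho> n * prod_list (map a js) \<le> window_factor * prod_list (map (pmf q) js)"
proof -
  define D where "D = sum_list (map v js) - \<rho> * real n"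
  have js: "\<forall>j\<in>set js. j \<ge> 1" "sum_list js = n" "\<bar>D\<bar> \<le> 1"
    using assms by (auto simp: mem_constraint_set D_def)
  have "\<bar>gamma_c a v * D\<bar> \<le> \<bar>gamma_c a v\<bar>"
    unfolding abs_mult using js(3) by (intro mult_left_le) auto
  hence D: "exp (gamma_c a v * D) \<le> window_factor" "exp (- (gamma_c a v * D)) \<le> window_factor" by auto
  have "gamma_c a v * sum_list (map v js) = gamma_c a v * \<rho> * real n + gamma_c a v * D"
    by (simp add: D_def algebra_simps)
  hence eq: "prod_list (map (pmf q) js) = (tilt \<rho> n * prod_list (map a js)) * exp (gamma_c a v * D)"
    using prod_list_q[OF js(1)] js(2) by (simp add: tilt_def exp_add)
  have pos: "tilt \<rho> n * prod_list (map a js) \<ge> 0"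
    using tilt_pos[of \<rho> n] prod_list_a_pos[OF js(1)] by simp
  show "prod_list (map (pmf q) js) \<le> tilt \<rho> n * window_factor * prod_list (map a js)"
    using mult_left_mono[OF D(1) pos] by (simp add: eq mult_ac)
  have "tilt \<rho> n * prod_list (map a js) = prod_list (map (pmf q) js) * exp (- (gamma_c a v * D))"
    by (simp add: eq exp_minus)
  also have "\<dots> \<le> prod_list (map (pmf q) js) * window_factor"
    using D(2) pos unfolding eq by (intro mult_left_mono) auto
  finally show "tilt \<rho> n * prod_list (map a js) \<le> window_factor * prod_list (map (pmf q) js)"
    by (simp add: mult.commute)
qed

lemma hit_prob_le_W: "hit_prob \<rho> n k \<le> tilt \<rho> n * window_factor * W a v \<rho> n k"
  unfolding hit_prob_eq W_eq sum_distrib_left by (intro sum_mono prod_list_q_bounds)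

lemma W_le_hit_prob: "tilt \<rho> n * W a v \<rho> n k \<le> window_factor * hit_prob \<rho> n k"
  unfolding hit_prob_eq W_eq sum_distrib_left by (intro sum_mono prod_list_q_bounds)

lemma W_pos_of_hit_prob_pos: "hit_prob \<rho> n k > 0 \<Longrightarrow> W a v \<rho> n k > 0"
  using hit_prob_le_W[of \<rho> n k] tilt_pos[of \<rho> n]
  by (metis exp_gt_zero less_le_trans mult_pos_pos zero_less_mult_pos)

text \<open>
  \<open>W\<close> is \<open>hit_prob\<close> divided by a factor which does not depend on \<open>k\<close>, up to \<open>window_factor\<close>; so a maximizer of
  \<open>W\<close> almost maximizes \<open>hit_prob\<close>.
\<close>

lemma hit_prob_le_maximizer:
  assumes "is_maximizer a v \<rho> n k" "1 \<le> k'" "k' \<le> n"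
  shows "hit_prob \<rho> n k' \<le> window_factor\<^sup>2 * hit_prob \<rho> n k"
proof -
  have "W a v \<rho> n k' \<le> W a v \<rho> n k"
    using assms by (auto simp: is_maximizer_def is_arg_max_def not_less)
  hence "tilt \<rho> n * window_factor * W a v \<rho> n k' \<le> tilt \<rho> n * window_factor * W a v \<rho> n k"
    using tilt_pos[of \<rho> n] by (intro mult_left_mono) auto
  hence "hit_prob \<rho> n k' \<le> tilt \<rho> n * window_factor * W a v \<rho> n k" by (rule order_trans[OF hit_prob_le_W])
  also have "\<dots> = window_factor * (tilt \<rho> n * W a v \<rho> n k)" by simp
  also have "\<dots> \<le> window_factor * (window_factor * hit_prob \<rho> n k)" by (intro mult_left_mono W_le_hit_prob) auto
  finally show ?thesis by (simp add: power2_eq_square mult_ac)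
qed

lemma pmf_mu:
  assumes "W a v \<rho> n k > 0"
  shows "pmf (mu a v \<rho> n k) js = (if js \<in> constraint_set v \<rho> n k
     then prod_list (map a js) / W a v \<rho> n k else 0)"
proof -
  let ?S = "constraint_set v \<rho> n k"
  let ?f = "\<lambda>js. if js \<in> ?S then prod_list (map a js) / W a v \<rho> n k else 0"
  have nonneg: "?f js \<ge> 0" for js
    using assms prod_list_a_pos[of js] by (auto simp: mem_constraint_set less_imp_le)
  have "(\<integral>\<^sup>+ js. ennreal (?f js) \<partial>count_space UNIV) = (\<Sum>js\<in>?S. ennreal (?f js))"
    by (intro nn_integral_count_space') (auto simp: finite_constraint_set)
  also have "\<dots> = ennreal (\<Sum>js\<in>?S. ?f js)" by (intro sum_ennreal nonneg)
  also have "(\<Sum>js\<in>?S. ?f js) = 1"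
    using assms by (simp add: W_eq flip: sum_divide_distrib)
  finally have one: "(\<integral>\<^sup>+ js. ennreal (?f js) \<partial>count_space UNIV) = 1" by simp
  have "mu a v \<rho> n k = embed_pmf ?f"
    unfolding mu_def
    by (intro arg_cong[of _ _ embed_pmf] ext)
      (auto simp: mem_constraint_set simp flip: prod_list_map_eq_prod)
  thus ?thesis using pmf_embed_pmf[of ?f, OF nonneg one] by simp
qed

lemma set_pmf_mu: "W a v \<rho> n k > 0 \<Longrightarrow> set_pmf (mu a v \<rho> n k) \<subseteq> constraint_set v \<rho> n k"
  by (auto simp: set_pmf_iff pmf_mu split: if_splits)

lemma finite_set_pmf_mu: "W a v \<rho> n k > 0 \<Longrightarrow> finite (set_pmf (mu a v \<rho> n k))"
  by (rule finite_subset[OF set_pmf_mu finite_constraint_set])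

lemma pmf_mu_le:
  assumes "hit_prob \<rho> n k > 0"
  shows "pmf (mu a v \<rho> n k) js \<le> window_factor\<^sup>2 / hit_prob \<rho> n k * pmf (replicate_pmf k q) js"
proof (cases "js \<in> constraint_set v \<rho> n k")
  case True
  have W: "W a v \<rho> n k > 0" by (rule W_pos_of_hit_prob_pos[OF assms])
  have a: "prod_list (map a js) > 0" using True by (intro prod_list_a_pos) (auto simp: mem_constraint_set)
  have "(tilt \<rho> n * prod_list (map a js)) * hit_prob \<rho> n k
      \<le> (window_factor * prod_list (map (pmf q) js)) * (tilt \<rho> n * window_factor * W a v \<rho> n k)"
  proof (rule mult_mono[OF prod_list_q_bounds(2)[OF True] hit_prob_le_W])
    show "0 \<le> window_factor * prod_list (map (pmf q) js)"
      using prod_list_q_bounds(2)[OF True] mult_pos_pos[OF tilt_pos[of \<rho> n] a] by linarith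
  qed (use assms in simp)
  hence "tilt \<rho> n * (prod_list (map a js) * hit_prob \<rho> n k)
      \<le> tilt \<rho> n * (window_factor\<^sup>2 * prod_list (map (pmf q) js) * W a v \<rho> n k)"
    by (simp add: power2_eq_square mult_ac)
  hence "prod_list (map a js) * hit_prob \<rho> n k \<le> window_factor\<^sup>2 * prod_list (map (pmf q) js) * W a v \<rho> n k"
    using tilt_pos[of \<rho> n] by simp
  moreover have "length js = k" using True by (simp add: mem_constraint_set)
  ultimately show ?thesis using True W assms by (simp add: pmf_mu pmf_replicate_pmf field_simps)
next
  case False
  thus ?thesis using W_pos_of_hit_prob_pos[OF assms] assms by (simp add: pmf_mu)
qed

text \<open>
  Both the constraints and the weights are symmetric in the coordinates. Cyclic shifts are all that is needed: they
  move any block to the front.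
\<close>

lemma expectation_mu_rotate:
  fixes g :: "nat list \<Rightarrow> real"
  assumes W: "W a v \<rho> n k > 0"
  shows "measure_pmf.expectation (mu a v \<rho> n k) (\<lambda>js. g (rotate i js))
    = measure_pmf.expectation (mu a v \<rho> n k) g"
proof -
  let ?S = "constraint_set v \<rho> n k"
  have sums': "sum_list (rotate i js) = sum_list js" for js :: "nat list"
    using sum_list_map_rotate[of "\<lambda>x. x"] by simp
  note sums = sum_list_map_rotate prod_list_map_rotate
  have inj: "inj_on (rotate i) ?S" 
    unfolding rotate_def by (rule inj_on_subset[OF inj_fn[OF inj_rotate1]]) simp
  have sub: "rotate i ` ?S \<subseteq> ?S" by (auto simp: mem_constraint_set sums sums')
  have bij: "bij_betw (rotate i) ?S ?S"
    using endo_inj_surj[OF finite_constraint_set sub inj] inj by (simp add: bij_betw_def)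
  have exp_eq: "measure_pmf.expectation (mu a v \<rho> n k) h
      = (\<Sum>js\<in>?S. h js * (prod_list (map a js) / W a v \<rho> n k))" for h :: "nat list \<Rightarrow> real"
    using set_pmf_mu[OF W]
    by (subst integral_measure_pmf_real[OF finite_constraint_set[of \<rho> n k]]) (auto simp: pmf_mu[OF W] intro!: sum.cong)
  show ?thesis unfolding exp_eq
    by (rule sum.reindex_bij_betw[OF bij, of "\<lambda>js. g js * (prod_list (map a js) / W a v \<rho> n k)", simplified sums])
qed

lemma expectation_mu_block:
  fixes g :: "nat list \<Rightarrow> real"
  assumes W: "W a v \<rho> n k > 0" and i: "Suc i * r \<le> k"
  shows "measure_pmf.expectation (mu a v \<rho> n k) (\<lambda>js. g (take r (drop (i * r) js)))
    = measure_pmf.expectation (mu_marginal a v \<rho> n k r) g"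
proof -
  have "measure_pmf.expectation (mu a v \<rho> n k) (\<lambda>js. g (take r (drop (i * r) js)))
      = measure_pmf.expectation (mu a v \<rho> n k) (\<lambda>js. g (take r (rotate (i * r) js)))"
  proof (intro integral_cong_AE, simp, simp, subst AE_measure_pmf_iff, intro ballI)
    fix js assume "js \<in> set_pmf (mu a v \<rho> n k)"
    hence len: "length js = k" using set_pmf_mu[OF W] by (auto simp: mem_constraint_set)
    have "take r (rotate (i * r) js) = take r (drop (i * r) js)"
    proof (cases "i * r < k")
      case True
      thus ?thesis using len i by (simp add: rotate_drop_take)
    next
      case False
      hence "r = 0" using i by simp
      thus ?thesis by simp
    qed
    thus "g (take r (drop (i * r) js)) = g (take r (rotate (i * r) js))" by simp
  qed
  also have "\<dots> = measure_pmf.expectation (mu a v \<rho> n k) (\<lambda>js. g (take r js))"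
    by (rule expectation_mu_rotate[OF W, of "\<lambda>js. g (take r js)"])
  finally show ?thesis by (simp add: mu_marginal_def)
qed

text \<open>
  The law \<open>mu\<close> has density at most \<open>window_factor^2 / hit_prob\<close> with respect to independent sampling, where the
  exponential moment of a sum over disjoint blocks factorizes.
\<close>

lemma expectation_mu_abs_sum_le:
  fixes g :: "nat list \<Rightarrow> real"
  assumes hit_prob: "hit_prob \<rho> n k \<ge> exp (- L)" and br: "b * r \<le> k" and th: "\<theta> > 0"
    and mgf: "\<And>t. \<bar>t\<bar> = \<theta> \<Longrightarrow> (\<integral>\<^sup>+ xs. ennreal (exp (t * g xs)) \<partial>replicate_pmf r q) \<le> ennreal (exp (C * \<theta>\<^sup>2))"
  shows "measure_pmf.expectation (mu a v \<rho> n k) (\<lambda>js. \<bar>\<Sum>i<b. g (take r (drop (i * r) js))\<bar>)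
    \<le> (ln 2 + 2 * \<bar>gamma_c a v\<bar> + L + real b * C * \<theta>\<^sup>2) / \<theta>"
proof -
  have pos: "hit_prob \<rho> n k > 0" using hit_prob exp_gt_zero[of "- L"] by linarith
  note W = W_pos_of_hit_prob_pos[OF pos]
  define K where "K = window_factor\<^sup>2 * exp L"
  have K: "K > 0" by (simp add: K_def)
  have dom: "pmf (mu a v \<rho> n k) js \<le> K * pmf (replicate_pmf k q) js" for js
  proof -
    have "window_factor\<^sup>2 / hit_prob \<rho> n k \<le> window_factor\<^sup>2 / exp (- L)" using hit_prob pos by (intro divide_left_mono) auto
    also have "\<dots> = K" by (simp add: K_def exp_minus field_simps)
    finally show ?thesis using pmf_mu_le[OF pos, of js] by (meson mult_right_mono order_trans pmf_nonneg)
  qed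
  have blocks: "(\<integral>\<^sup>+ js. ennreal (exp (t * (\<Sum>i<b. g (take r (drop (i * r) js))))) \<partial>replicate_pmf k q)
      \<le> ennreal (exp (real b * C * \<theta>\<^sup>2))" if t: "\<bar>t\<bar> = \<theta>" for t
  proof -
    have "ennreal (exp (t * (\<Sum>i<b. g (take r (drop (i * r) js)))))
        = (\<Prod>i<b. ennreal (exp (t * g (take r (drop (i * r) js)))))" for js
      by (subst prod_ennreal) (auto simp: sum_distrib_left exp_sum)
    hence "(\<integral>\<^sup>+ js. ennreal (exp (t * (\<Sum>i<b. g (take r (drop (i * r) js))))) \<partial>replicate_pmf k q)
        = (\<integral>\<^sup>+ js. (\<Prod>i<b. ennreal (exp (t * g (take r (drop (i * r) js))))) \<partial>replicate_pmf k q)"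
      by simp
    also have "\<dots> = (\<integral>\<^sup>+ xs. ennreal (exp (t * g xs)) \<partial>replicate_pmf r q) ^ b"
      by (rule nn_integral_replicate_blocks[OF br])
    also have "\<dots> \<le> ennreal (exp (C * \<theta>\<^sup>2)) ^ b" by (intro power_mono mgf t) auto
    also have "\<dots> = ennreal (exp (real b * C * \<theta>\<^sup>2))"
      by (simp add: ennreal_power mult.assoc flip: exp_of_nat_mult)
    finally show ?thesis .
  qed
  have "measure_pmf.expectation (mu a v \<rho> n k) (\<lambda>js. \<bar>\<Sum>i<b. g (take r (drop (i * r) js))\<bar>)
      \<le> (ln 2 + ln K + real b * C * \<theta>\<^sup>2) / \<theta>"
    using th by (intro expectation_abs_le_of_dominated[OF finite_set_pmf_mu[OF W] dom K th] blocks) auto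
  also have "ln K = 2 * \<bar>gamma_c a v\<bar> + L" by (simp add: K_def ln_mult ln_realpow)
  finally show ?thesis by (simp add: algebra_simps)
qed

end

section \<open>The size of the condensate and the error scale\<close>

lemma eventually_const_less_linear:
  assumes "c > 0"
  shows "\<forall>\<^sub>F n in sequentially. K < c * real n"
proof -
  have "\<forall>\<^sub>F n in sequentially. K / c < real n"
    using filterlim_real_sequentially by (auto simp: filterlim_at_top_dense)
  thus ?thesis by eventually_elim (use assms in \<open>simp add: field_simps\<close>)
qed

lemma eventually_const_less_sqrt:
  assumes "c > 0"
  shows "\<forall>\<^sub>F n in sequentially. K < c * sqrt (real n)"
proof -
  have "filterlim (\<lambda>n. sqrt (real n)) at_top sequentially"
    by (rule filterlim_compose[OF sqrt_at_top filterlim_real_sequentially])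
  hence "\<forall>\<^sub>F n in sequentially. K / c < sqrt (real n)" by (auto simp: filterlim_at_top_dense)
  thus ?thesis by eventually_elim (use assms in \<open>simp add: field_simps\<close>)
qed

locale supercritical = profile +
  fixes \<rho> :: real
  assumes rho_gt: "\<rho> > rho_c a v"
begin

abbreviation s :: "nat \<Rightarrow> nat" where "s n \<equiv> s_idx a v \<rho> n"

text \<open>
  A coordinate of size \<open>m\<close> carries \<open>excess m\<close> more than the share \<open>\<rho>\<^sub>c m\<close> that goes with its size. A single coordinate
  of size \<open>s n\<close> therefore covers the whole surplus \<open>gap * n\<close>.
\<close>

definition excess :: "nat \<Rightarrow> real" where "excess m = v m - rho_c a v * real m"

definition gap :: real where "gap = \<rho> - rho_c a v"

lemma gap_pos: "gap > 0"
  using rho_gt by (simp add: gap_def)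

lemma s_spec: "s n \<ge> 1" "excess (s n) \<ge> gap * real n"
proof -
  have "\<forall>\<^sub>F m in sequentially. (rho_c a v + 1) * real m \<le> v m" by (rule v_eventually_ge_linear)
  then obtain M where M: "\<And>m. m \<ge> M \<Longrightarrow> (rho_c a v + 1) * real m \<le> v m"
    by (auto simp: eventually_sequentially)
  define m where "m = max 1 (max M (nat \<lceil>gap * real n\<rceil>))"
  have "excess m \<ge> real m" using M[of m] by (simp add: m_def excess_def algebra_simps)
  moreover have "real m \<ge> gap * real n" unfolding m_def by linarith
  ultimately have "m \<ge> 1 \<and> excess m \<ge> gap * real n" by (simp add: m_def)
  hence "1 \<le> s n \<and> (\<rho> - rho_c a v) * real n \<le> v (s n) - rho_c a v * real (s n)"
    unfolding s_idx_def by (intro LeastI_ex[where P = "\<lambda>m. 1 \<le> m \<and> _ m"]) (auto simp: excess_def gap_def)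
  thus "s n \<ge> 1" "excess (s n) \<ge> gap * real n" by (simp_all add: excess_def gap_def)
qed

lemma excess_less: "1 \<le> m \<Longrightarrow> m < s n \<Longrightarrow> excess m < gap * real n"
  unfolding s_idx_def by (drule not_less_Least) (auto simp: excess_def gap_def)

lemma xi_eq: "xi a v \<rho> n = excess (s n) - gap * real n"
  by (simp add: xi_def excess_def gap_def)

lemma xi_nonneg: "xi a v \<rho> n \<ge> 0"
  using s_spec(2)[of n] by (simp add: xi_eq)

lemma s_at_top: "filterlim s at_top sequentially"
  unfolding filterlim_at_top
proof
  fix M
  define K where "K = (\<Sum>m\<le>M. \<bar>excess m\<bar>)"
  have "\<forall>\<^sub>F n in sequentially. K < gap * real n" using gap_pos by (rule eventually_const_less_linear)
  thus "\<forall>\<^sub>F n in sequentially. M \<le> s n"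
  proof eventually_elim
    case (elim n)
    show ?case
    proof (rule ccontr)
      assume "\<not> M \<le> s n"
      hence "\<bar>excess (s n)\<bar> \<le> K" unfolding K_def by (intro member_le_sum) auto
      thus False using s_spec(2)[of n] elim by linarith
    qed
  qed
qed

lemma s_pred_at_top: "filterlim (\<lambda>n. s n - 1) at_top sequentially"
  using s_at_top by (rule filterlim_compose[OF filterlim_minus_const_nat_at_top])

text \<open>
  Below \<open>s n\<close> the excess is at most \<open>gap * n\<close>, while it outgrows every linear function.
\<close>

lemma s_small:
  assumes "\<epsilon> > 0"
  shows "\<forall>\<^sub>F n in sequentially. real (s n) \<le> \<epsilon> * real n"
proof -
  have "\<forall>\<^sub>F m in sequentially. (rho_c a v + 2 * gap / \<epsilon>) * real m \<le> v m"
    by (rule v_eventually_ge_linear)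
  hence "\<forall>\<^sub>F n in sequentially. (rho_c a v + 2 * gap / \<epsilon>) * real (s n - 1) \<le> v (s n - 1)"
    by (rule eventually_compose_filterlim[OF _ s_pred_at_top])
  moreover have "\<forall>\<^sub>F n in sequentially. s n - 1 \<ge> 1"
    using s_pred_at_top by (auto simp: filterlim_at_top)
  moreover have "\<forall>\<^sub>F n in sequentially. 1 < \<epsilon> / 2 * real n"
    using assms by (intro eventually_const_less_linear) simp
  ultimately show ?thesis
  proof eventually_elim
    case (elim n)
    have "2 * gap / \<epsilon> * real (s n - 1) \<le> excess (s n - 1)"
      using elim(1) by (simp add: excess_def algebra_simps)
    also have "\<dots> < gap * real n" using elim by (intro excess_less) auto
    finally have "gap * (2 / \<epsilon> * real (s n - 1)) < gap * real n" by (simp add: algebra_simps)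
    hence "2 / \<epsilon> * real (s n - 1) < real n" using gap_pos by (simp only: mult_less_cancel_left_pos)
    hence "real (s n - 1) < \<epsilon> / 2 * real n" using assms by (simp add: field_simps)
    moreover have "real (s n) = real (s n - 1) + 1" using elim by (simp add: of_nat_diff)
    ultimately show ?case using elim(3) by linarith
  qed
qed

text \<open>
  The excess of \<open>s n - 1\<close> is still below \<open>gap * n\<close>, so the overshoot is at most one increment of the excess, and
  increments of \<open>v\<close> are \<open>O(sqrt v)\<close>.
\<close>

lemma xi_le_sqrt: obtains C where "C > 0" "\<forall>\<^sub>F n in sequentially. xi a v \<rho> n \<le> C * sqrt (real n)"
proof -
  define A where "A = 9 * (gap + \<bar>rho_c a v\<bar>)"
  have A: "A > 0" using gap_pos by (simp add: A_def)
  have "\<forall>\<^sub>F n in sequentially. (fdiff v (s n - 1))\<^sup>2 \<le> 9 * v (s n - 1)"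
    by (rule eventually_compose_filterlim[OF fdiff_square_le s_pred_at_top])
  moreover have "\<forall>\<^sub>F n in sequentially. s n - 1 \<ge> 1"
    using s_pred_at_top by (auto simp: filterlim_at_top)
  ultimately have "\<forall>\<^sub>F n in sequentially. xi a v \<rho> n \<le> (sqrt A + \<bar>rho_c a v\<bar>) * sqrt (real n)"
    using s_small[of 1, OF zero_less_one] eventually_ge_at_top[of 1]
  proof eventually_elim
    case (elim n)
    have lt: "excess (s n - 1) < gap * real n" using elim by (intro excess_less) auto
    have "v (s n - 1) \<le> gap * real n + rho_c a v * real (s n - 1)" using lt by (simp add: excess_def)
    also have "rho_c a v * real (s n - 1) \<le> \<bar>rho_c a v\<bar> * real n"
      using elim(3) by (intro mult_mono) auto
    finally have "(fdiff v (s n - 1))\<^sup>2 \<le> A * real n"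
      using elim(1) by (simp add: A_def algebra_simps)
    hence fd: "fdiff v (s n - 1) \<le> sqrt A * sqrt (real n)"
      using A by (metis real_le_rsqrt real_sqrt_mult)
    obtain p where p: "s n = Suc p" using s_spec(1)[of n] by (cases "s n") auto
    have "xi a v \<rho> n = (excess p - gap * real n) + fdiff v p - rho_c a v"
      unfolding xi_eq p by (simp add: excess_def fdiff_def algebra_simps)
    hence "xi a v \<rho> n = (excess (s n - 1) - gap * real n) + fdiff v (s n - 1) - rho_c a v"
      by (simp add: p)
    hence "xi a v \<rho> n \<le> sqrt A * sqrt (real n) + \<bar>rho_c a v\<bar>" using lt fd by linarith
    also have "\<bar>rho_c a v\<bar> \<le> \<bar>rho_c a v\<bar> * sqrt (real n)"
      using elim(4) mult_left_mono[of 1 "sqrt (real n)" "\<bar>rho_c a v\<bar>"] by simp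
    finally show ?case by (simp add: algebra_simps)
  qed
  thus ?thesis using that[of "sqrt A + \<bar>rho_c a v\<bar>"] A by (simp add: add_pos_nonneg)
qed

lemma v_s_le: obtains C where "C > 0" "\<forall>\<^sub>F n in sequentially. v (s n) \<le> C * real n"
proof -
  obtain C where C: "C > 0" "\<forall>\<^sub>F n in sequentially. xi a v \<rho> n \<le> C * sqrt (real n)" by (rule xi_le_sqrt)
  have "\<forall>\<^sub>F n in sequentially. v (s n) \<le> (gap + C + \<bar>rho_c a v\<bar>) * real n"
    using C(2) s_small[of 1, OF zero_less_one] eventually_ge_at_top[of 1]
  proof eventually_elim
    case (elim n)
    have "rho_c a v * real (s n) \<le> \<bar>rho_c a v\<bar> * real n" using elim by (intro mult_mono) auto
    moreover have "C * sqrt (real n) \<le> C * real n"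
      using C(1) elim real_sqrt_le_iff[of "real n" "(real n)\<^sup>2"]
      by (intro mult_left_mono) (auto simp: power2_eq_square real_sqrt_le_iff)
    ultimately show ?case using elim(1) by (simp add: xi_eq excess_def algebra_simps)
  qed
  thus ?thesis using that[of "gap + C + \<bar>rho_c a v\<bar>"] C gap_pos by simp
qed

text \<open>
  The excess of \<open>s n\<close> is at least linear in \<open>n\<close>, but at most quadratic in \<open>s n\<close>.
\<close>

lemma s_ge_sqrt: obtains c where "c > 0" "\<And>n. c * sqrt (real n) \<le> real (s n)"
proof -
  obtain C where C: "C > 0" "\<And>j. j \<ge> 1 \<Longrightarrow> v j \<le> C * (real j)\<^sup>2"
    using v_le_quadratic by blast
  define A where "A = C + \<bar>rho_c a v\<bar>"
  have A: "A > 0" using C by (simp add: A_def)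
  have "sqrt (gap / A) * sqrt (real n) \<le> real (s n)" for n
  proof -
    have s1: "real (s n) \<ge> 1" using s_spec(1)[of n] by simp
    hence "real (s n) \<le> (real (s n))\<^sup>2" by (simp add: power2_eq_square)
    hence "- rho_c a v * real (s n) \<le> \<bar>rho_c a v\<bar> * (real (s n))\<^sup>2"
      by (intro mult_mono) auto
    moreover have "gap * real n \<le> excess (s n)" by (rule s_spec)
    ultimately have "gap * real n \<le> A * (real (s n))\<^sup>2"
      using C(2)[OF s_spec(1)[of n]] by (simp add: excess_def A_def algebra_simps)
    hence "gap / A * real n \<le> (real (s n))\<^sup>2" using A by (simp add: field_simps)
    hence "sqrt (gap / A * real n) \<le> real (s n)" by (simp add: real_le_lsqrt)
    thus ?thesis by (simp only: real_sqrt_mult)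
  qed
  thus ?thesis using that[of "sqrt (gap / A)"] A gap_pos by simp
qed

definition cost :: "nat \<Rightarrow> real"
  where "cost n = - ln (pmf q (s n)) + ln (real n)"

text \<open>
  Exponential tails of \<open>q\<close> together with \<open>s n \<ge> c sqrt n\<close>. Hence \<open>exp (- C sqrt n)\<close> is
  eventually at least some fixed power of \<open>q (s n)\<close>.
\<close>

lemma sqrt_le_ln_pmf: obtains c where "c > 0"
  "\<forall>\<^sub>F n in sequentially. c * sqrt (real n) \<le> - ln (pmf q (s n))"
proof -
  obtain c where c: "c > 0" "\<And>n. c * sqrt (real n) \<le> real (s n)"
    using s_ge_sqrt by blast
  obtain \<delta> K where K: "\<delta> > 0" "K > 0" "\<And>j. pmf q j \<le> K * exp (- \<delta> * real j)"
    using pmf_q_exp_tail by blast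
  have "\<forall>\<^sub>F n in sequentially. ln K < \<delta> * c / 2 * sqrt (real n)"
    using K(1) c(1) by (intro eventually_const_less_sqrt) simp
  hence "\<forall>\<^sub>F n in sequentially. \<delta> * c / 2 * sqrt (real n) \<le> - ln (pmf q (s n))"
  proof eventually_elim
    case (elim n)
    have "ln (pmf q (s n)) \<le> ln (K * exp (- \<delta> * real (s n)))"
      using pmf_q_pos[OF s_spec(1)] K by (subst ln_le_cancel_iff) auto
    also have "\<dots> = ln K - \<delta> * real (s n)" using K by (simp add: ln_mult)
    also have "\<dots> \<le> ln K - \<delta> * (c * sqrt (real n))"
      using mult_left_mono[OF c(2)[of n], of \<delta>] K by simp
    finally show ?case using elim by (simp add: mult.assoc)
  qed
  thus ?thesis using that[of "\<delta> * c / 2"] K c by simp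
qed

lemma cost_ge: obtains c where "c > 0"
  "\<forall>\<^sub>F n in sequentially. c * sqrt (real n) \<le> cost n \<and> ln (real n) \<le> cost n \<and> 1 \<le> cost n"
proof -
  obtain c where c: "c > 0" "\<forall>\<^sub>F n in sequentially. c * sqrt (real n) \<le> - ln (pmf q (s n))"
    by (rule sqrt_le_ln_pmf)
  have "\<forall>\<^sub>F n in sequentially. 1 < c * sqrt (real n)" using c(1) by (rule eventually_const_less_sqrt)
  with c(2) have "\<forall>\<^sub>F n in sequentially. c * sqrt (real n) \<le> cost n \<and> ln (real n) \<le> cost n \<and> 1 \<le> cost n"
    using eventually_ge_at_top[of 1]
  proof eventually_elim
    case (elim n)
    have "ln (real n) \<ge> 0" using elim by simp
    thus ?case using elim unfolding cost_def by linarith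
  qed
  with c(1) that show ?thesis by blast
qed

text \<open>
  \<open>- ln q (s n) = o(v (s n))\<close>, and \<open>v (s n)\<close> is at most of order \<open>n\<close>.
\<close>

lemma cost_over_n: "(\<lambda>n. cost n / real n) \<longlonglongrightarrow> 0"
proof -
  obtain C where C: "C > 0" "\<forall>\<^sub>F n in sequentially. v (s n) \<le> C * real n" by (rule v_s_le)
  have lim: "(\<lambda>n. - ln (pmf q (s n)) / v (s n)) \<longlonglongrightarrow> 0"
    by (rule filterlim_compose[OF ln_pmf_q_small s_at_top])
  have "(\<lambda>n. - ln (pmf q (s n)) / real n) \<longlonglongrightarrow> 0"
  proof (rule Lim_null_comparison)
    show "(\<lambda>n. \<bar>- ln (pmf q (s n)) / v (s n)\<bar> * C) \<longlonglongrightarrow> 0"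
      using tendsto_mult_right[OF tendsto_rabs[OF lim], of C] by simp
    have "\<forall>\<^sub>F n in sequentially. 1 * real (s n) \<le> v (s n)"
      by (rule eventually_compose_filterlim[OF v_eventually_ge_linear s_at_top])
    with C(2) show "\<forall>\<^sub>F n in sequentially. norm (- ln (pmf q (s n)) / real n)
        \<le> \<bar>- ln (pmf q (s n)) / v (s n)\<bar> * C"
      using eventually_ge_at_top[of 1]
    proof eventually_elim
      case (elim n)
      have vpos: "v (s n) > 0" using elim s_spec(1)[of n] by linarith
      have "\<bar>ln (pmf q (s n))\<bar> * v (s n) \<le> \<bar>ln (pmf q (s n))\<bar> * (C * real n)"
        using elim by (intro mult_left_mono) auto
      thus ?case using vpos elim by (simp add: abs_divide field_simps)
    qed
  qed
  moreover have "(\<lambda>n. ln (real n) / real n) \<longlonglongrightarrow> 0" by real_asymp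
  ultimately have "(\<lambda>n. - ln (pmf q (s n)) / real n + ln (real n) / real n) \<longlonglongrightarrow> 0 + 0"
    by (rule tendsto_add)
  thus ?thesis by (simp add: cost_def add_divide_distrib diff_divide_distrib)
qed

lemma sqrt_cost_le_omega: "sqrt (cost n / real n) \<le> omega a v \<rho> n"
  using xi_nonneg[of n] by (simp add: omega_def cost_def)

end

section \<open>A lower bound for the constraint probability\<close>

lemma length_le_sum_list: "\<forall>j\<in>set js. j \<ge> 1 \<Longrightarrow> length js \<le> sum_list js" for js :: "nat list"
  by (induction js) auto

lemma sum_list_map_real: "sum_list (map real xs) = real (sum_list xs)"
  by (induction xs) auto

lemma sum_list_map_diff_const:
  "sum_list (map (\<lambda>x. f x - c) xs) = sum_list (map f xs) - real (length xs) * c" for c :: real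
  by (induction xs) (auto simp: algebra_simps)

context profile
begin

text \<open>
  An entry \<open>j\<close> has the logarithmic price \<open>- ln q(j) \<le> v j + C j\<close>, so the price of a list is controlled by its two
  totals, whatever its entries are.
\<close>

lemma prod_list_q_ge: obtains C where "C \<ge> 0" "\<And>L. \<forall>j\<in>set L. j \<ge> 1 \<Longrightarrow>
    exp (- (sum_list (map v L) + C * real (sum_list L))) \<le> prod_list (map (pmf q) L)"
proof -
  obtain C where C: "C \<ge> 0" "\<And>j. j \<ge> 1 \<Longrightarrow> - ln (pmf q j) \<le> v j + C * real j"
    using ln_pmf_q_le by blast
  have "exp (- (sum_list (map v L) + C * real (sum_list L))) \<le> prod_list (map (pmf q) L)"
    if "\<forall>j\<in>set L. j \<ge> 1" for L
    using that
  proof (induction L)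
    case (Cons j L)
    have "- (v j + C * real j) \<le> ln (pmf q j)" using C(2)[of j] Cons.prems by simp
    hence "exp (- (v j + C * real j)) \<le> pmf q j" using pmf_q_pos[of j] Cons.prems by (simp add: ln_ge_iff)
    hence "exp (- (v j + C * real j)) * exp (- (sum_list (map v L) + C * real (sum_list L)))
        \<le> pmf q j * prod_list (map (pmf q) L)"
      using Cons by (intro mult_mono) auto
    moreover have "- (sum_list (map v (j # L)) + C * real (sum_list (j # L)))
        = - (v j + C * real j) + - (sum_list (map v L) + C * real (sum_list L))"
      by (simp add: algebra_simps)
    ultimately show ?case by (simp only: exp_add list.map prod_list.Cons)
  qed simp
  with C(1) that show ?thesis by blast
qed

text \<open>
  The slopes on either side of \<open>\<rho>\<^sub>c\<close> leave a cone around the line \<open>y = \<rho>\<^sub>c x\<close> in which, apart from a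
  bounded margin \<open>c\<close>, every pair of totals can be realized.
\<close>

lemma completion_near_rho_c: obtains \<kappa> c where "0 < \<kappa>" "0 \<le> c"
  "\<And>x y. \<bar>y - rho_c a v * real x\<bar> \<le> \<kappa> * real x - c \<Longrightarrow>
    \<exists>L. (\<forall>j\<in>set L. j \<ge> 1) \<and> sum_list L = x \<and> \<bar>sum_list (map v L) - y\<bar> \<le> 1"
proof -
  obtain j1 j2 where j: "j1 \<ge> 1" "j2 \<ge> 1" "v j1 / real j1 < rho_c a v" "rho_c a v < v j2 / real j2"
    by (rule ratios_around_rho_c)
  have "v j1 / real j1 < v j2 / real j2" using j by linarith
  then obtain c0 where c0: "\<And>x y. c0 \<le> real x \<Longrightarrow> v j1 / real j1 * real x + c0 \<le> y \<Longrightarrow>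
    y \<le> v j2 / real j2 * real x - c0 \<Longrightarrow>
    \<exists>L. (\<forall>j\<in>set L. j \<ge> 1) \<and> sum_list L = x \<and> \<bar>sum_list (map v L) - y\<bar> \<le> 1"
    using completion_list[OF j(1,2)] by blast
  define \<kappa> where "\<kappa> = min 1 (min (rho_c a v - v j1 / real j1) (v j2 / real j2 - rho_c a v))"
  have k: "0 < \<kappa>" "\<kappa> \<le> 1" "\<kappa> \<le> rho_c a v - v j1 / real j1" "\<kappa> \<le> v j2 / real j2 - rho_c a v"
    using j by (auto simp: \<kappa>_def)
  show ?thesis
  proof (rule that[of \<kappa> "\<bar>c0\<bar>"])
    fix x :: nat and y :: real
    assume y: "\<bar>y - rho_c a v * real x\<bar> \<le> \<kappa> * real x - \<bar>c0\<bar>"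
    have m: "\<kappa> * real x \<le> 1 * real x" "\<kappa> * real x \<le> (rho_c a v - v j1 / real j1) * real x"
      "\<kappa> * real x \<le> (v j2 / real j2 - rho_c a v) * real x"
      by (rule mult_right_mono[OF k(2)], simp, rule mult_right_mono[OF k(3)], simp,
          rule mult_right_mono[OF k(4)], simp)
    note m' = m(2,3)[unfolded left_diff_distrib]
    have lo: "rho_c a v * real x - y \<le> \<kappa> * real x - \<bar>c0\<bar>" and up: "y - rho_c a v * real x \<le> \<kappa> * real x - \<bar>c0\<bar>"
      using y by (auto simp: abs_le_iff)
    show "\<exists>L. (\<forall>j\<in>set L. j \<ge> 1) \<and> sum_list L = x \<and> \<bar>sum_list (map v L) - y\<bar> \<le> 1"
    proof (rule c0)
      show "c0 \<le> real x" using m(1) lo up by linarith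
      show "v j1 / real j1 * real x + c0 \<le> y" using m'(1) lo by linarith
      show "y \<le> v j2 / real j2 * real x - c0" using m'(2) up by linarith
    qed
  qed (use k in auto)
qed

definition typical :: "real \<Rightarrow> nat \<Rightarrow> nat list set"
  where "typical r k = {js. length js = k \<and> (\<forall>j\<in>set js. j \<ge> 1)
    \<and> \<bar>real (sum_list js) - real k * mean\<bar> < r
    \<and> \<bar>sum_list (map v js) - real k * (rho_c a v * mean)\<bar> < r}"

lemma prob_typical_ge_half: obtains A where "A > 0"
  "\<And>k R. R > 0 \<Longrightarrow> real k \<le> R\<^sup>2 \<Longrightarrow> 1/2 \<le> measure_pmf.prob (replicate_pmf k q) (typical (A * R) k)"
proof -
  define g1 g2 where "g1 = (\<lambda>j. real j - mean)" and "g2 = (\<lambda>j. v j - rho_c a v * mean)"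
  have sq1: "integrable q (\<lambda>j. (g1 j)\<^sup>2)"
    unfolding g1_def power2_diff using integrable_real integrable_real_square by auto
  have sq2: "integrable q (\<lambda>j. (g2 j)\<^sup>2)"
    unfolding g2_def power2_diff using integrable_v integrable_v_square by auto
  have m1: "measure_pmf.expectation q g1 = 0"
    unfolding g1_def using integrable_real by (simp add: mean_def)
  have m2: "measure_pmf.expectation q g2 = 0"
    unfolding g2_def using integrable_v expectation_v by simp
  define V where "V = measure_pmf.expectation q (\<lambda>j. (g1 j)\<^sup>2) + measure_pmf.expectation q (\<lambda>j. (g2 j)\<^sup>2)"
  have V: "measure_pmf.expectation q (\<lambda>j. (g1 j)\<^sup>2) \<le> V" "measure_pmf.expectation q (\<lambda>j. (g2 j)\<^sup>2) \<le> V" "V \<ge> 0"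
    by (auto simp: V_def)
  define A where "A = 1 + 4 * V"
  have A: "A > 0" "4 * V \<le> A\<^sup>2" using V(3) by (auto simp: A_def power2_eq_square algebra_simps)
  have "1/2 \<le> measure_pmf.prob (replicate_pmf k q) (typical (A * R) k)" if R: "R > 0" "real k \<le> R\<^sup>2" for k R
  proof -
    let ?M = "measure_pmf (replicate_pmf k q)"
    let ?B = "\<lambda>g::nat \<Rightarrow> real. {xs. A * R \<le> \<bar>sum_list (map g xs)\<bar>}"
    have quarter: "measure ?M (?B g) \<le> 1/4"
      if g: "integrable q (\<lambda>j. (g j)\<^sup>2)" "measure_pmf.expectation q g = 0"
        "measure_pmf.expectation q (\<lambda>j. (g j)\<^sup>2) \<le> V" for g :: "nat \<Rightarrow> real"
    proof -
      have "measure ?M (?B g) \<le> real k * measure_pmf.expectation q (\<lambda>j. (g j)\<^sup>2) / (A * R)\<^sup>2"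
        using A R by (intro chebyshev_replicate_pmf g) auto
      also have "\<dots> \<le> R\<^sup>2 * V / (A * R)\<^sup>2" using R g by (intro divide_right_mono mult_mono) auto
      also have "\<dots> = V / A\<^sup>2" using R by (simp add: power_mult_distrib)
      also have "\<dots> \<le> 1/4" using A by (simp add: divide_le_eq)
      finally show ?thesis .
    qed
    have sub: "set_pmf (replicate_pmf k q) \<subseteq> typical (A * R) k \<union> (?B g1 \<union> ?B g2)"
    proof
      fix xs assume "xs \<in> set_pmf (replicate_pmf k q)"
      hence xs: "length xs = k" "\<forall>j\<in>set xs. j \<ge> 1" by (auto simp: set_replicate_pmf set_pmf_q)
      have "sum_list (map g1 xs) = real (sum_list xs) - real k * mean"
        unfolding g1_def sum_list_map_diff_const xs(1) by (simp add: sum_list_map_real)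
      moreover have "sum_list (map g2 xs) = sum_list (map v xs) - real k * (rho_c a v * mean)"
        unfolding g2_def sum_list_map_diff_const xs(1) by simp
      ultimately show "xs \<in> typical (A * R) k \<union> (?B g1 \<union> ?B g2)"
        using xs by (auto simp: typical_def)
    qed
    have "1 = measure ?M (set_pmf (replicate_pmf k q))"
      using measure_Int_set_pmf[of "replicate_pmf k q" UNIV] by simp
    also have "\<dots> \<le> measure ?M (typical (A * R) k \<union> (?B g1 \<union> ?B g2))"
      using sub by (intro measure_pmf.finite_measure_mono) auto
    also have "\<dots> \<le> measure ?M (typical (A * R) k) + (measure ?M (?B g1) + measure ?M (?B g2))"
      by (intro order_trans[OF measure_Un_le] add_left_mono measure_Un_le) auto
    finally show ?thesis using quarter[OF sq1 m1 V(1)] quarter[OF sq2 m2 V(2)] by linarith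
  qed
  with A(1) that show ?thesis by blast
qed

text \<open>
  Appending a tail to each list of length \<open>k0\<close> is injective, since the first \<open>k0\<close> entries recover the list. The sum
  over all \<open>k\<close> allows the lengths of the tails to vary.
\<close>

lemma sum_hit_prob_ge:
  assumes fin: "finite G" and len: "\<And>js. js \<in> G \<Longrightarrow> length js = k0"
    and mem: "\<And>js. js \<in> G \<Longrightarrow> js @ F js \<in> constraint_set v \<rho> n (length (js @ F js))"
    and ne: "\<And>js. js \<in> G \<Longrightarrow> F js \<noteq> []"
    and eta: "\<And>js. js \<in> G \<Longrightarrow> \<eta> \<le> prod_list (map (pmf q) (F js))"
  shows "\<eta> * measure_pmf.prob (replicate_pmf k0 q) G \<le> (\<Sum>k=1..n. hit_prob \<rho> n k)"
proof -
  let ?w = "\<lambda>js. prod_list (map (pmf q) js)"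
  have w0: "?w js \<ge> 0" for js by (induction js) auto
  let ?U = "\<Union>k\<in>{1..n}. constraint_set v \<rho> n k"
  have "(\<Sum>k=1..n. hit_prob \<rho> n k) = sum ?w ?U"
    unfolding hit_prob_eq
    by (rule sum.UNION_disjoint[symmetric]) (auto simp: finite_constraint_set, auto simp: mem_constraint_set)
  moreover have "sum ?w ((\<lambda>js. js @ F js) ` G) \<le> sum ?w ?U"
  proof (intro sum_mono2 w0)
    show "finite ?U" using finite_constraint_set by auto
    show "(\<lambda>js. js @ F js) ` G \<subseteq> ?U"
    proof safe
      fix js assume js: "js \<in> G"
      have "length (js @ F js) \<le> n"
        using mem[OF js] length_le_sum_list[of "js @ F js"] by (simp add: mem_constraint_set)
      moreover have "1 \<le> length (js @ F js)" using ne[OF js] by (cases "F js") auto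
      ultimately show "js @ F js \<in> ?U" using mem[OF js] by (intro UN_I[of "length (js @ F js)"]) auto
    qed
  qed
  moreover have "sum ?w ((\<lambda>js. js @ F js) ` G) = (\<Sum>js\<in>G. ?w js * ?w (F js))"
  proof (subst sum.reindex)
    show "inj_on (\<lambda>js. js @ F js) G" using len by (auto intro!: inj_onI)
  qed simp
  moreover have "\<eta> * measure_pmf.prob (replicate_pmf k0 q) G = (\<Sum>js\<in>G. ?w js * \<eta>)"
    unfolding measure_measure_pmf_finite[OF fin] sum_distrib_left
    by (intro sum.cong) (auto simp: pmf_replicate_pmf len)
  moreover have "(\<Sum>js\<in>G. ?w js * \<eta>) \<le> (\<Sum>js\<in>G. ?w js * ?w (F js))"
    by (intro sum_mono mult_left_mono eta w0)
  ultimately show ?thesis by linarith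
qed

end

context supercritical
begin

text \<open>
  A tuple is built from one coordinate \<open>s n\<close>, a typical sample of \<open>k0\<close> coordinates and a completing list. The value
  of \<open>k0\<close> leaves a sum of about \<open>B sqrt n\<close> to the completing list, with \<open>B\<close> so large that the fluctuations
  \<open>O(sqrt n)\<close> of the sample keep its two totals \<open>x\<close> and \<open>y\<close> inside the cone of \<open>completion_near_rho_c\<close>.
\<close>

lemma sum_hit_prob_lower: obtains E where
  "\<forall>\<^sub>F n in sequentially. 1/2 * (pmf q (s n) * exp (- E * sqrt (real n))) \<le> (\<Sum>k=1..n. hit_prob \<rho> n k)"
proof -
  obtain A where A: "A > 0" "\<And>k R. R > 0 \<Longrightarrow> real k \<le> R\<^sup>2 \<Longrightarrow>
      1/2 \<le> measure_pmf.prob (replicate_pmf k q) (typical (A * R) k)"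
    using prob_typical_ge_half by blast
  obtain \<kappa> c where kc: "0 < \<kappa>" "0 \<le> c"
    "\<And>x y. \<bar>y - rho_c a v * real x\<bar> \<le> \<kappa> * real x - c \<Longrightarrow>
      \<exists>L. (\<forall>j\<in>set L. j \<ge> 1) \<and> sum_list L = x \<and> \<bar>sum_list (map v L) - y\<bar> \<le> 1"
    using completion_near_rho_c by blast
  obtain C0 where C0: "C0 \<ge> 0" "\<And>L. \<forall>j\<in>set L. j \<ge> 1 \<Longrightarrow>
      exp (- (sum_list (map v L) + C0 * real (sum_list L))) \<le> prod_list (map (pmf q) L)"
    using prod_list_q_ge by blast
  obtain C1 where C1: "C1 > 0" "\<forall>\<^sub>F n in sequentially. xi a v \<rho> n \<le> C1 * sqrt (real n)"
    by (rule xi_le_sqrt)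
  define D where "D = \<bar>rho_c a v\<bar> * A + A + C1"
  \<comment> \<open>reserve for the completing list: its sum is at least \<open>(B - A) sqrt n\<close>, and then
    \<open>\<kappa> (B - A) sqrt n - c\<close> dominates the deviation \<open>D sqrt n\<close> of its \<open>v\<close>-total\<close>
  define B where "B = A + (D + c) / \<kappa>"
  define X where "X = B + A + mean"
  define E where "E = \<bar>rho_c a v\<bar> * X + D + 1 + C0 * X"
  have D: "D > 0" using A C1 by (simp add: D_def add_nonneg_pos)
  have B: "A \<le> B" "\<kappa> * (B - A) = D + c" using D kc by (auto simp: B_def)
  have X0: "X > 0" using A B mean_ge_1 by (simp add: X_def)
  have "\<forall>\<^sub>F n in sequentially. 2 * B < 1 * sqrt (real n)" by (rule eventually_const_less_sqrt) simp
  moreover have "\<forall>\<^sub>F n in sequentially. real (s n) \<le> 1/2 * real n" by (rule s_small) simp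
  ultimately have "\<forall>\<^sub>F n in sequentially.
      1/2 * (pmf q (s n) * exp (- E * sqrt (real n))) \<le> (\<Sum>k=1..n. hit_prob \<rho> n k)"
    using C1(2) eventually_ge_at_top[of 1]
  proof eventually_elim
    case (elim n)
    define R where "R = sqrt (real n)"
    have R: "R \<ge> 1" "R\<^sup>2 = real n" using elim by (auto simp: R_def)
    define N where "N = n - s n"
    have N: "real N = real n - real (s n)" "real N \<ge> real n / 2" "N + s n = n"
      using elim by (auto simp: N_def of_nat_diff)
    have "2 * B * R \<le> R * R" using elim(1) R by (intro mult_right_mono) (auto simp: R_def)
    hence BR: "B * R \<le> real N" using N(2) R(2) by (simp add: power2_eq_square)
    define k0 where "k0 = nat \<lfloor>(real N - B * R) / mean\<rfloor>"
    have k0: "real k0 * mean \<le> real N - B * R" "real N - B * R \<le> real k0 * mean + mean"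
    proof -
      have "0 \<le> (real N - B * R) / mean" using BR mean_ge_1 by simp
      hence "real k0 \<le> (real N - B * R) / mean" "(real N - B * R) / mean \<le> real k0 + 1"
        unfolding k0_def by linarith+
      thus "real k0 * mean \<le> real N - B * R" "real N - B * R \<le> real k0 * mean + mean"
        using mean_ge_1 by (simp_all add: field_simps)
    qed
    have AR: "A * R > 0" "A * R \<le> B * R" using A B R by (auto intro: mult_right_mono)
    have k0n: "real k0 \<le> R\<^sup>2"
    proof -
      have "real k0 * 1 \<le> real k0 * mean" using mean_ge_1 by (intro mult_left_mono) auto
      thus ?thesis using k0(1) AR N R by linarith
    qed
    define G where "G = typical (A * R) k0"
    have prob: "1/2 \<le> measure_pmf.prob (replicate_pmf k0 q) G"
      unfolding G_def using k0n R by (intro A(2)) auto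
    have S: "sum_list js < N" if "js \<in> G" for js
    proof -
      have "real (sum_list js) < real k0 * mean + A * R"
        using that by (auto simp: G_def typical_def abs_less_iff)
      hence "real (sum_list js) < real N" using k0(1) AR by linarith
      thus ?thesis by simp
    qed
    have finG: "finite G"
    proof (rule finite_subset)
      show "G \<subseteq> {js. set js \<subseteq> {..N} \<and> length js = k0}"
      proof safe
        fix js j assume js: "js \<in> G" "j \<in> set js"
        have "j \<le> sum_list js" using js(2) by (rule member_le_sum_list) simp
        thus "j \<le> N" using S[OF js(1)] by simp
      qed (simp add: G_def typical_def)
    qed (auto intro: finite_lists_length_eq)
    define x where "x js = N - sum_list js" for js
    define y where "y js = rho_c a v * real N - xi a v \<rho> n - sum_list (map v js)" for js
    have x: "real (x js) = real N - real (sum_list js)" "(B - A) * R \<le> real (x js)" "real (x js) \<le> X * R"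
      and yx: "\<bar>y js - rho_c a v * real (x js)\<bar> \<le> D * R" if js: "js \<in> G" for js
    proof -
      have dS: "\<bar>real (sum_list js) - real k0 * mean\<bar> < A * R"
        and dV: "\<bar>sum_list (map v js) - real k0 * (rho_c a v * mean)\<bar> < A * R"
        using js by (auto simp: G_def typical_def)
      show xr: "real (x js) = real N - real (sum_list js)"
        using S[OF js] by (simp add: x_def of_nat_diff)
      have dS': "real (sum_list js) < real k0 * mean + A * R" "real k0 * mean - A * R < real (sum_list js)"
        using dS by (auto simp: abs_less_iff)
      show "(B - A) * R \<le> real (x js)" using dS' k0(1) xr by (simp add: algebra_simps)
      have "mean \<le> mean * R" using R mean_ge_1 by simp
      thus "real (x js) \<le> X * R" using dS' k0(2) xr by (simp add: X_def algebra_simps)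
      have "y js - rho_c a v * real (x js) = rho_c a v * (real (sum_list js) - real k0 * mean)
          - (sum_list (map v js) - real k0 * (rho_c a v * mean)) - xi a v \<rho> n"
        by (simp add: y_def xr algebra_simps)
      moreover have "\<bar>rho_c a v * (real (sum_list js) - real k0 * mean)\<bar> \<le> \<bar>rho_c a v\<bar> * (A * R)"
        unfolding abs_mult using dS by (intro mult_left_mono) auto
      moreover have "\<bar>xi a v \<rho> n\<bar> \<le> C1 * R" using elim(3) xi_nonneg[of n] by (simp add: R_def)
      moreover have "D * R = \<bar>rho_c a v\<bar> * (A * R) + A * R + C1 * R" by (simp add: D_def algebra_simps)
      ultimately show "\<bar>y js - rho_c a v * real (x js)\<bar> \<le> D * R" using dV by linarith
    qed
    have "\<exists>L. (\<forall>j\<in>set L. j \<ge> 1) \<and> sum_list L = x js \<and> \<bar>sum_list (map v L) - y js\<bar> \<le> 1"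
      if js: "js \<in> G" for js
    proof (rule kc(3))
      have "\<kappa> * ((B - A) * R) \<le> \<kappa> * real (x js)" using kc x(2)[OF js] by (intro mult_left_mono) auto
      hence "(D + c) * R \<le> \<kappa> * real (x js)" using B(2) by (simp add: mult.assoc[symmetric])
      moreover have "c \<le> c * R" using kc(2) R(1) mult_left_mono[of 1 R c] by simp
      ultimately show "\<bar>y js - rho_c a v * real (x js)\<bar> \<le> \<kappa> * real (x js) - c"
        using yx[OF js] by (simp add: algebra_simps)
    qed
    then obtain L where L: "\<And>js. js \<in> G \<Longrightarrow> \<forall>j\<in>set (L js). j \<ge> 1"
      "\<And>js. js \<in> G \<Longrightarrow> sum_list (L js) = x js"
      "\<And>js. js \<in> G \<Longrightarrow> \<bar>sum_list (map v (L js)) - y js\<bar> \<le> 1"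
      by metis
    have vs: "v (s n) = \<rho> * real n - rho_c a v * real N + xi a v \<rho> n"
      by (simp add: xi_eq excess_def gap_def N(1) algebra_simps)
    have "pmf q (s n) * exp (- E * R) * measure_pmf.prob (replicate_pmf k0 q) G \<le> (\<Sum>k=1..n. hit_prob \<rho> n k)"
    proof (rule sum_hit_prob_ge[OF finG, where F = "\<lambda>js. s n # L js"])
      fix js assume js: "js \<in> G"
      show len: "length js = k0" using js by (simp add: G_def typical_def)
      have ge1: "\<forall>j\<in>set js. j \<ge> 1" using js by (simp add: G_def typical_def)
      have "sum_list js + (s n + x js) = n" using S[OF js] N(3) by (simp add: x_def)
      moreover have "sum_list (map v (js @ s n # L js)) - \<rho> * real n = sum_list (map v (L js)) - y js"
        by (simp add: vs y_def)
      ultimately show "js @ s n # L js \<in> constraint_set v \<rho> n (length (js @ s n # L js))"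
        unfolding mem_constraint_set using ge1 L[OF js] s_spec(1)[of n] by auto
      have "sum_list (map v (L js)) + C0 * real (sum_list (L js)) \<le> E * R"
      proof -
        have "sum_list (map v (L js)) \<le> y js + 1" using L(3)[OF js] by (auto simp: abs_le_iff)
        moreover have "y js \<le> rho_c a v * real (x js) + D * R" using yx[OF js] by (auto simp: abs_le_iff)
        moreover have "rho_c a v * real (x js) \<le> \<bar>rho_c a v\<bar> * (X * R)"
          using x(3)[OF js] by (intro mult_mono) auto
        moreover have "C0 * real (sum_list (L js)) \<le> C0 * (X * R)"
          unfolding L(2)[OF js] using C0(1) x(3)[OF js] by (intro mult_left_mono) auto
        moreover have "E * R = \<bar>rho_c a v\<bar> * (X * R) + D * R + R + C0 * (X * R)"
          by (simp add: E_def algebra_simps)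
        ultimately show ?thesis using R(1) by linarith
      qed
      hence "exp (- E * R) \<le> prod_list (map (pmf q) (L js))"
        by (intro order_trans[OF _ C0(2)[OF L(1)[OF js]]]) simp
      thus "pmf q (s n) * exp (- E * R) \<le> prod_list (map (pmf q) (s n # L js))"
        by (simp add: mult_left_mono)
    qed simp
    moreover have "pmf q (s n) * exp (- E * R) * (1/2)
        \<le> pmf q (s n) * exp (- E * R) * measure_pmf.prob (replicate_pmf k0 q) G"
      using prob by (intro mult_left_mono) auto
    ultimately show ?case by (simp add: R_def)
  qed
  thus ?thesis using that[of E] by blast
qed

text \<open>
  Among the \<open>n\<close> admissible values of \<open>k\<close> the best one carries at least the fraction \<open>1/n\<close> of the sum, and the
  maximizer is almost the best. The factors \<open>exp (- E sqrt n)\<close> and \<open>1/n\<close> are absorbed by multiples of the cost.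
\<close>

lemma hit_prob_maximizer_lower: obtains C where "C > 0"
  "\<forall>\<^sub>F n in sequentially. \<forall>k. is_maximizer a v \<rho> n k \<longrightarrow> exp (- C * cost n) \<le> hit_prob \<rho> n k"
proof -
  obtain E where E: "\<forall>\<^sub>F n in sequentially.
      1/2 * (pmf q (s n) * exp (- E * sqrt (real n))) \<le> (\<Sum>k=1..n. hit_prob \<rho> n k)"
    by (rule sum_hit_prob_lower)
  obtain c where c: "c > 0"
    "\<forall>\<^sub>F n in sequentially. c * sqrt (real n) \<le> cost n \<and> ln (real n) \<le> cost n \<and> 1 \<le> cost n"
    by (rule cost_ge)
  define C where "C = 1 + \<bar>E\<bar> / c + ln 2 + 2 * \<bar>gamma_c a v\<bar>"
  have C: "C > 0" using c by (simp add: C_def add_pos_nonneg)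
  from E c(2) have "\<forall>\<^sub>F n in sequentially. \<forall>k. is_maximizer a v \<rho> n k \<longrightarrow> exp (- C * cost n) \<le> hit_prob \<rho> n k"
    using eventually_ge_at_top[of 1]
  proof (eventually_elim, intro allI impI)
    fix n k
    assume low: "1/2 * (pmf q (s n) * exp (- E * sqrt (real n))) \<le> (\<Sum>k=1..n. hit_prob \<rho> n k)"
      and cst: "c * sqrt (real n) \<le> cost n \<and> ln (real n) \<le> cost n \<and> 1 \<le> cost n"
      and n: "1 \<le> n" and mx: "is_maximizer a v \<rho> n k"
    have "(\<Sum>k=1..n. hit_prob \<rho> n k) \<le> (\<Sum>k'=1..n. window_factor\<^sup>2 * hit_prob \<rho> n k)"
      using mx by (intro sum_mono hit_prob_le_maximizer) auto
    also have "\<dots> = real n * window_factor\<^sup>2 * hit_prob \<rho> n k" by simp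
    finally have le: "pmf q (s n) * exp (- E * sqrt (real n)) \<le> 2 * real n * window_factor\<^sup>2 * hit_prob \<rho> n k"
      using low by simp
    have q0: "pmf q (s n) > 0" by (rule pmf_q_pos[OF s_spec(1)])
    have "E * sqrt (real n) \<le> \<bar>E\<bar> / c * cost n"
    proof -
      have "E * sqrt (real n) \<le> \<bar>E\<bar> * sqrt (real n)" by (intro mult_right_mono) auto
      also have "\<dots> = \<bar>E\<bar> / c * (c * sqrt (real n))" using c by simp
      also have "\<dots> \<le> \<bar>E\<bar> / c * cost n" using cst c(1) by (intro mult_left_mono) auto
      finally show ?thesis .
    qed
    moreover have "(ln 2 + 2 * \<bar>gamma_c a v\<bar>) * 1 \<le> (ln 2 + 2 * \<bar>gamma_c a v\<bar>) * cost n"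
      using cst by (intro mult_left_mono) auto
    ultimately have "cost n + E * sqrt (real n) + (ln 2 + 2 * \<bar>gamma_c a v\<bar>) \<le> C * cost n"
      by (simp add: C_def algebra_simps)
    hence "exp (- C * cost n) \<le> exp (- (cost n + E * sqrt (real n) + (ln 2 + 2 * \<bar>gamma_c a v\<bar>)))"
      by simp
    also have "\<dots> = pmf q (s n) * exp (- E * sqrt (real n)) / (2 * real n * window_factor\<^sup>2)"
    proof -
      have eq: "- (cost n + E * sqrt (real n) + (ln 2 + 2 * \<bar>gamma_c a v\<bar>))
          = ln (pmf q (s n)) + (- E * sqrt (real n)) - (ln 2 + ln (real n) + (\<bar>gamma_c a v\<bar> + \<bar>gamma_c a v\<bar>))"
        by (simp add: cost_def)
      have e: "exp (ln (pmf q (s n))) = pmf q (s n)" "exp (ln (real n)) = real n" "exp (ln 2) = (2::real)"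
        using q0 n by auto
      show ?thesis unfolding eq exp_diff exp_add e by (simp add: power2_eq_square)
    qed
    also have "\<dots> \<le> hit_prob \<rho> n k" using le n by (simp add: divide_le_eq mult_ac)
    finally show "exp (- C * cost n) \<le> hit_prob \<rho> n k" .
  qed
  with C that show ?thesis by blast
qed

end

section \<open>Concentration under the microcanonical law\<close>

text \<open>
  Choose levels \<open>M j\<close> with error eventually below \<open>1/(j+1)\<close>, from some threshold \<open>N j\<close> on, and at time \<open>n\<close> use the
  largest \<open>j \<le> n\<close> whose threshold has been passed.
\<close>

lemma diagonal_sequence:
  fixes F :: "nat \<Rightarrow> nat \<Rightarrow> real"
  assumes "\<And>\<epsilon>. \<epsilon> > 0 \<Longrightarrow> \<exists>M0. \<forall>M\<ge>M0. \<forall>\<^sub>F n in sequentially. \<bar>F n M\<bar> < \<epsilon>"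
  obtains m :: "nat \<Rightarrow> nat" where "filterlim m at_top sequentially" "(\<lambda>n. F n (m n)) \<longlonglongrightarrow> 0"
proof -
  have "\<forall>j. \<exists>M N. M \<ge> j \<and> (\<forall>n\<ge>N. \<bar>F n M\<bar> < 1 / real (Suc j))"
  proof
    fix j
    obtain M0 where "\<forall>M\<ge>M0. \<forall>\<^sub>F n in sequentially. \<bar>F n M\<bar> < 1 / real (Suc j)"
      using assms[of "1 / real (Suc j)"] by auto
    hence "\<forall>\<^sub>F n in sequentially. \<bar>F n (max j M0)\<bar> < 1 / real (Suc j)" by simp
    thus "\<exists>M N. M \<ge> j \<and> (\<forall>n\<ge>N. \<bar>F n M\<bar> < 1 / real (Suc j))"
      unfolding eventually_sequentially using max.cobounded1[of j M0] by blast
  qed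
  then obtain M N where MN: "\<And>j. M j \<ge> j" "\<And>j n. n \<ge> N j \<Longrightarrow> \<bar>F n (M j)\<bar> < 1 / real (Suc j)"
    by metis
  \<comment> \<open>inserting 0 keeps the maximum defined for the finitely many \<open>n\<close> with no admissible index\<close>
  define J where "J n = Max (insert 0 {j. j \<le> n \<and> N j \<le> n})" for n
  have J_ge: "j \<le> J n" if "n \<ge> max j (N j)" for j n
    unfolding J_def by (rule Max_ge) (use that in auto)
  have J_mem: "N (J n) \<le> n" if "n \<ge> N 0" for n
  proof -
    have "J n \<in> insert 0 {j. j \<le> n \<and> N j \<le> n}" unfolding J_def by (rule Max_in) auto
    thus ?thesis using that by auto
  qed
  show ?thesis
  proof (rule that[of "\<lambda>n. M (J n)"])
    show "filterlim (\<lambda>n. M (J n)) at_top sequentially"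
      unfolding filterlim_at_top eventually_sequentially
      using J_ge MN(1) by (meson order_trans)
    show "(\<lambda>n. F n (M (J n))) \<longlonglongrightarrow> 0"
    proof (rule LIMSEQ_I)
      fix \<epsilon> :: real assume e: "\<epsilon> > 0"
      obtain j where j: "1 / real (Suc j) < \<epsilon>" using reals_Archimedean[OF e] by (auto simp: inverse_eq_divide)
      have "norm (F n (M (J n)) - 0) < \<epsilon>" if n: "n \<ge> max (N 0) (max j (N j))" for n
      proof -
        have "\<bar>F n (M (J n))\<bar> < 1 / real (Suc (J n))" using MN(2)[OF J_mem] n by simp
        also have "\<dots> \<le> 1 / real (Suc j)" using J_ge[of j n] n by (simp add: frac_le)
        finally show ?thesis using j by simp
      qed
      thus "\<exists>n0. \<forall>n\<ge>n0. norm (F n (M (J n)) - 0) < \<epsilon>" by blast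
    qed
  qed
qed

lemma nn_integral_replicate_1: "(\<integral>\<^sup>+ xs. f xs \<partial>replicate_pmf (Suc 0) p) = (\<integral>\<^sup>+ x. f [x] \<partial>p)"
  by simp

lemma nn_integral_exp_le_bounded:
  fixes g :: "'a \<Rightarrow> real"
  assumes B: "\<And>x. \<bar>g x\<bar> \<le> B" and mean0: "measure_pmf.expectation p g = 0" and th: "\<bar>\<theta>\<bar> \<le> 1"
  shows "(\<integral>\<^sup>+ x. ennreal (exp (\<theta> * g x)) \<partial>p) \<le> ennreal (exp ((B\<^sup>2 * exp B) * \<theta>\<^sup>2))"
proof -
  have B0: "B \<ge> 0" using B[of undefined] by linarith
  have le: "(g x)\<^sup>2 * exp (1 * \<bar>g x\<bar>) \<le> B\<^sup>2 * exp B" for x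
    using B[of x] B0 by (intro mult_mono) (auto simp: abs_le_square_iff[symmetric])
  have int: "integrable (measure_pmf p) f" if "\<And>x. \<bar>f x\<bar> \<le> c" for f :: "'a \<Rightarrow> real" and c
    using that by (intro measure_pmf.integrable_const_bound[where B = c]) auto
  have int2: "integrable (measure_pmf p) (\<lambda>x. (g x)\<^sup>2 * exp (1 * \<bar>g x\<bar>))"
    by (rule int[where c = "B\<^sup>2 * exp B"]) (use le in simp)
  have "measure_pmf.expectation p (\<lambda>x. (g x)\<^sup>2 * exp (1 * \<bar>g x\<bar>)) \<le> measure_pmf.expectation p (\<lambda>_. B\<^sup>2 * exp B)"
    by (intro integral_mono int2 le) auto
  thus ?thesis using th by (intro nn_integral_exp_le_gaussian[OF int[OF B] mean0 int2]) auto
qed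

context profile
begin

lemma exp_moment_centred: obtains \<tau> where "\<tau> > 0"
  "integrable q (\<lambda>j. (real j - mean)\<^sup>2 * exp (\<tau> * \<bar>real j - mean\<bar>))"
proof -
  obtain \<delta> where d: "\<delta> > 0" "integrable q (\<lambda>j. exp (\<delta> * real j))" by (rule exp_moment)
  have "\<forall>\<^sub>F j in sequentially. (real j)\<^sup>2 \<le> exp (\<delta> / 2 * real j)" using d(1) by real_asymp
  moreover have "\<forall>\<^sub>F j in sequentially. mean < 1 * real j" by (rule eventually_const_less_linear) simp
  ultimately have "\<forall>\<^sub>F j in sequentially.
      \<bar>(real j - mean)\<^sup>2 * exp (\<delta> / 2 * \<bar>real j - mean\<bar>)\<bar> \<le> exp (\<delta> * real j)"
  proof eventually_elim
    case (elim j)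
    have j: "\<bar>real j - mean\<bar> \<le> real j" using elim mean_ge_1 by simp
    have "(real j - mean)\<^sup>2 \<le> (real j)\<^sup>2" using j by (simp add: abs_le_square_iff[symmetric])
    also have "\<dots> \<le> exp (\<delta> / 2 * real j)" by (rule elim)
    finally have "(real j - mean)\<^sup>2 * exp (\<delta> / 2 * \<bar>real j - mean\<bar>)
        \<le> exp (\<delta> / 2 * real j) * exp (\<delta> / 2 * real j)"
      using j d(1) by (intro mult_mono) auto
    also have "\<dots> = exp (\<delta> * real j)" by (simp flip: exp_add)
    finally show ?case by simp
  qed
  from integrable_of_eventually_le[OF d(2) this] d(1) that[of "\<delta> / 2"] show ?thesis by simp
qed

end

locale maximizing = supercritical +
  fixes k :: "nat \<Rightarrow> nat"
  assumes k_max: "\<And>n. n \<ge> 1 \<Longrightarrow> is_maximizer a v \<rho> n (k n)"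
begin

abbreviation \<mu> :: "nat \<Rightarrow> nat list pmf" where "\<mu> n \<equiv> mu a v \<rho> n (k n)"

definition err :: "nat \<Rightarrow> real" where "err n = sqrt (cost n / real n)"

lemma k_bounds: "n \<ge> 1 \<Longrightarrow> 1 \<le> k n" "n \<ge> 1 \<Longrightarrow> k n \<le> n"
  using k_max[of n] by (auto simp: is_maximizer_def is_arg_max_def)

lemma err_tendsto_0: "err \<longlonglongrightarrow> 0"
  using tendsto_real_sqrt[OF cost_over_n] by (simp add: err_def[abs_def])

lemma err_pos: "\<forall>\<^sub>F n in sequentially. err n > 0"
proof -
  obtain c where "\<forall>\<^sub>F n in sequentially. c * sqrt (real n) \<le> cost n \<and> ln (real n) \<le> cost n \<and> 1 \<le> cost n"
    using cost_ge by blast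
  thus ?thesis using eventually_ge_at_top[of 1] by eventually_elim (auto simp: err_def)
qed

lemma hit_prob_lower: obtains C where "C > 0" "\<forall>\<^sub>F n in sequentially. exp (- C * cost n) \<le> hit_prob \<rho> n (k n)"
proof -
  obtain C where C: "C > 0"
    "\<forall>\<^sub>F n in sequentially. \<forall>k. is_maximizer a v \<rho> n k \<longrightarrow> exp (- C * cost n) \<le> hit_prob \<rho> n k"
    by (rule hit_prob_maximizer_lower)
  have "\<forall>\<^sub>F n in sequentially. exp (- C * cost n) \<le> hit_prob \<rho> n (k n)"
    using C(2) eventually_ge_at_top[of 1] by eventually_elim (use k_max in auto)
  with C(1) that show ?thesis by blast
qed

lemma W_pos: "\<forall>\<^sub>F n in sequentially. W a v \<rho> n (k n) > 0"
proof -
  obtain C where "\<forall>\<^sub>F n in sequentially. exp (- C * cost n) \<le> hit_prob \<rho> n (k n)"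
    using hit_prob_lower by blast
  thus ?thesis by eventually_elim (rule W_pos_of_hit_prob_pos, rule less_le_trans[OF exp_gt_zero])
qed

text \<open>
  The parameter \<open>\<theta> = err n\<close> balances the two contributions in \<open>expectation_mu_abs_sum_le\<close>, as it makes \<open>n \<theta>^2\<close>
  equal to \<open>cost n\<close>. The test function may vary with \<open>n\<close>, as the total variation distance requires.
\<close>

lemma concentration:
  assumes "\<tau> > 0" "C' \<ge> 0"
  obtains K where "K > 0" "\<forall>\<^sub>F n in sequentially. \<forall>b g. b * r \<le> k n \<longrightarrow> b \<le> n \<longrightarrow>
    (\<forall>\<theta>. \<bar>\<theta>\<bar> \<le> \<tau> \<longrightarrow> (\<integral>\<^sup>+ xs. ennreal (exp (\<theta> * g xs)) \<partial>replicate_pmf r q) \<le> ennreal (exp (C' * \<theta>\<^sup>2)))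
    \<longrightarrow> measure_pmf.expectation (\<mu> n) (\<lambda>js. \<bar>\<Sum>i<b. g (take r (drop (i * r) js))\<bar>) \<le> K * (real n * err n)"
proof -
  obtain C where C: "C > 0" "\<forall>\<^sub>F n in sequentially. exp (- C * cost n) \<le> hit_prob \<rho> n (k n)"
    by (rule hit_prob_lower)
  obtain c where c: "\<forall>\<^sub>F n in sequentially. c * sqrt (real n) \<le> cost n \<and> ln (real n) \<le> cost n \<and> 1 \<le> cost n"
    using cost_ge by blast
  define K0 where "K0 = ln 2 + 2 * \<bar>gamma_c a v\<bar>"
  have K0: "K0 > 0" by (simp add: K0_def add_pos_nonneg)
  define K where "K = K0 + C + C'"
  have K: "K > 0" using C(1) K0 assms by (simp add: K_def)
  have small: "\<forall>\<^sub>F n in sequentially. err n < \<tau>"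
    using err_tendsto_0 assms(1) by (rule order_tendstoD)
  have "\<forall>\<^sub>F n in sequentially. \<forall>b g. b * r \<le> k n \<longrightarrow> b \<le> n \<longrightarrow>
    (\<forall>\<theta>. \<bar>\<theta>\<bar> \<le> \<tau> \<longrightarrow> (\<integral>\<^sup>+ xs. ennreal (exp (\<theta> * g xs)) \<partial>replicate_pmf r q) \<le> ennreal (exp (C' * \<theta>\<^sup>2)))
    \<longrightarrow> measure_pmf.expectation (\<mu> n) (\<lambda>js. \<bar>\<Sum>i<b. g (take r (drop (i * r) js))\<bar>) \<le> K * (real n * err n)"
    using C(2) c err_pos small eventually_ge_at_top[of 1]
  proof (eventually_elim, intro allI impI)
    fix n b g
    assume low: "exp (- C * cost n) \<le> hit_prob \<rho> n (k n)"
      and cst: "c * sqrt (real n) \<le> cost n \<and> ln (real n) \<le> cost n \<and> 1 \<le> cost n"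
      and th: "0 < err n" "err n < \<tau>" and n: "1 \<le> n" and b: "b * r \<le> k n" "b \<le> n"
      and mgf: "\<forall>\<theta>. \<bar>\<theta>\<bar> \<le> \<tau> \<longrightarrow> (\<integral>\<^sup>+ xs. ennreal (exp (\<theta> * g xs)) \<partial>replicate_pmf r q) \<le> ennreal (exp (C' * \<theta>\<^sup>2))"
    have low': "exp (- (C * cost n)) \<le> hit_prob \<rho> n (k n)" using low by simp
    have mgf': "(\<integral>\<^sup>+ xs. ennreal (exp (t * g xs)) \<partial>replicate_pmf r q) \<le> ennreal (exp (C' * (err n)\<^sup>2))"
      if "\<bar>t\<bar> = err n" for t
    proof -
      have "t\<^sup>2 = (err n)\<^sup>2" using that by (metis power2_abs)
      thus ?thesis using mgf[rule_format, of t] that th by simp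
    qed
    have sq: "real n * (err n)\<^sup>2 = cost n" using n cst by (simp add: err_def)
    have "measure_pmf.expectation (\<mu> n) (\<lambda>js. \<bar>\<Sum>i<b. g (take r (drop (i * r) js))\<bar>)
        \<le> (ln 2 + 2 * \<bar>gamma_c a v\<bar> + C * cost n + real b * C' * (err n)\<^sup>2) / err n"
      by (rule expectation_mu_abs_sum_le[OF low' b(1) th(1) mgf'])
    also have "\<dots> \<le> K * cost n / err n"
    proof (rule divide_right_mono)
      have "K0 * 1 \<le> K0 * cost n" using K0 cst by (intro mult_left_mono) auto
      moreover have "real b * C' * (err n)\<^sup>2 \<le> real n * C' * (err n)\<^sup>2"
        using b assms by (intro mult_right_mono) auto
      moreover have "real n * C' * (err n)\<^sup>2 = C' * cost n" by (simp add: sq[symmetric])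
      moreover have "K * cost n = K0 * cost n + C * cost n + C' * cost n"
        by (simp add: K_def algebra_simps)
      ultimately show "ln 2 + 2 * \<bar>gamma_c a v\<bar> + C * cost n + real b * C' * (err n)\<^sup>2 \<le> K * cost n"
        unfolding K0_def[symmetric] by linarith
    qed (use th in simp)
    also have "\<dots> = K * (real n * err n)"
      unfolding sq[symmetric] using th by (simp add: power2_eq_square)
    finally show "measure_pmf.expectation (\<mu> n) (\<lambda>js. \<bar>\<Sum>i<b. g (take r (drop (i * r) js))\<bar>) \<le> K * (real n * err n)" .
  qed
  with K that show ?thesis by blast
qed

lemma concentration_sum_list:
  fixes f :: "nat \<Rightarrow> real"
  assumes t: "\<tau> > 0" "C' \<ge> 0"
    and mgf: "\<And>\<theta>. \<bar>\<theta>\<bar> \<le> \<tau> \<Longrightarrow> (\<integral>\<^sup>+ x. ennreal (exp (\<theta> * f x)) \<partial>q) \<le> ennreal (exp (C' * \<theta>\<^sup>2))"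
  obtains K where "K > 0" "\<forall>\<^sub>F n in sequentially.
    measure_pmf.expectation (\<mu> n) (\<lambda>js. \<bar>sum_list (map f js)\<bar>) \<le> K * (real n * err n)"
proof -
  obtain K where K: "K > 0" "\<forall>\<^sub>F n in sequentially. \<forall>b g. b * Suc 0 \<le> k n \<longrightarrow> b \<le> n \<longrightarrow>
    (\<forall>\<theta>. \<bar>\<theta>\<bar> \<le> \<tau> \<longrightarrow> (\<integral>\<^sup>+ xs. ennreal (exp (\<theta> * g xs)) \<partial>replicate_pmf (Suc 0) q) \<le> ennreal (exp (C' * \<theta>\<^sup>2)))
    \<longrightarrow> measure_pmf.expectation (\<mu> n) (\<lambda>js. \<bar>\<Sum>i<b. g (take (Suc 0) (drop (i * Suc 0) js))\<bar>) \<le> K * (real n * err n)"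
    using concentration[OF t] by blast
  have "\<forall>\<^sub>F n in sequentially.
    measure_pmf.expectation (\<mu> n) (\<lambda>js. \<bar>sum_list (map f js)\<bar>) \<le> K * (real n * err n)"
    using K(2) W_pos eventually_ge_at_top[of 1]
  proof eventually_elim
    case (elim n)
    have "measure_pmf.expectation (\<mu> n) (\<lambda>js. \<bar>\<Sum>i<k n. f (hd (take (Suc 0) (drop (i * Suc 0) js)))\<bar>)
        \<le> K * (real n * err n)"
      by (rule elim(1)[rule_format, where g = "\<lambda>xs. f (hd xs)"])
        (use k_bounds[OF elim(3)] mgf in \<open>auto simp del: replicate_pmf.simps simp: nn_integral_replicate_1\<close>)
    also have "measure_pmf.expectation (\<mu> n) (\<lambda>js. \<bar>\<Sum>i<k n. f (hd (take (Suc 0) (drop (i * Suc 0) js)))\<bar>)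
        = measure_pmf.expectation (\<mu> n) (\<lambda>js. \<bar>sum_list (map f js)\<bar>)"
    proof (intro integral_cong_AE, simp, simp, subst AE_measure_pmf_iff, intro ballI)
      fix js assume "js \<in> set_pmf (\<mu> n)"
      hence len: "length js = k n" using set_pmf_mu[OF elim(2)] by (auto simp: mem_constraint_set)
      have "(\<Sum>i<k n. f (hd (take (Suc 0) (drop (i * Suc 0) js)))) = (\<Sum>i<k n. f (js ! i))"
        using len by (intro sum.cong) (auto simp: hd_drop_conv_nth)
      also have "\<dots> = sum_list (map f js)"
        using len by (simp add: sum_list_sum_nth atLeast0LessThan)
      finally show "\<bar>\<Sum>i<k n. f (hd (take (Suc 0) (drop (i * Suc 0) js)))\<bar> = \<bar>sum_list (map f js)\<bar>" by simp
    qed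
    finally show ?case .
  qed
  with K(1) that show ?thesis by blast
qed

text \<open>
  Apply the concentration bound to \<open>\<Sum> (J_i - m)\<close>; both the sum and the number of the coordinates are fixed, so it
  is the constant \<open>n - k m\<close>.
\<close>

lemma fraction_deviation: obtains K where "K > 0"
  "\<forall>\<^sub>F n in sequentially. \<bar>real (k n) / real n - alpha_c a v\<bar> \<le> K * err n"
proof -
  obtain \<tau> where t: "\<tau> > 0" "integrable q (\<lambda>j. (real j - mean)\<^sup>2 * exp (\<tau> * \<bar>real j - mean\<bar>))"
    by (rule exp_moment_centred)
  define C' where "C' = measure_pmf.expectation q (\<lambda>j. (real j - mean)\<^sup>2 * exp (\<tau> * \<bar>real j - mean\<bar>))"
  have C': "C' \<ge> 0" unfolding C'_def by (rule Bochner_Integration.integral_nonneg) auto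
  have mgf: "(\<integral>\<^sup>+ j. ennreal (exp (\<theta> * (real j - mean))) \<partial>q) \<le> ennreal (exp (C' * \<theta>\<^sup>2))" if "\<bar>\<theta>\<bar> \<le> \<tau>" for \<theta>
    using that t(2) integrable_real
    by (intro nn_integral_exp_le_gaussian[where \<tau> = \<tau>]) (auto simp: C'_def mean_def)
  obtain K where K: "K > 0" "\<forall>\<^sub>F n in sequentially.
    measure_pmf.expectation (\<mu> n) (\<lambda>js. \<bar>sum_list (map (\<lambda>j. real j - mean) js)\<bar>) \<le> K * (real n * err n)"
    by (rule concentration_sum_list[OF t(1) C' mgf])
  have "\<forall>\<^sub>F n in sequentially. \<bar>real (k n) / real n - alpha_c a v\<bar> \<le> K * err n"
    using K(2) W_pos eventually_ge_at_top[of 1] err_pos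
  proof eventually_elim
    case (elim n)
    have "measure_pmf.expectation (\<mu> n) (\<lambda>js. \<bar>sum_list (map (\<lambda>j. real j - mean) js)\<bar>)
        = measure_pmf.expectation (\<mu> n) (\<lambda>js. \<bar>real n - real (k n) * mean\<bar>)"
    proof (intro integral_cong_AE, simp, simp, subst AE_measure_pmf_iff, intro ballI)
      fix js assume "js \<in> set_pmf (\<mu> n)"
      hence "length js = k n" "sum_list js = n" using set_pmf_mu[OF elim(2)] by (auto simp: mem_constraint_set)
      thus "\<bar>sum_list (map (\<lambda>j. real j - mean) js)\<bar> = \<bar>real n - real (k n) * mean\<bar>"
        by (simp add: sum_list_map_diff_const sum_list_map_real)
    qed
    hence le: "\<bar>real n - real (k n) * mean\<bar> \<le> K * (real n * err n)" using elim(1) by simp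
    have "real (k n) / real n - alpha_c a v = - (real n - real (k n) * mean) / (real n * mean)"
      using elim mean_ge_1 by (simp add: alpha_c_eq field_simps)
    hence "\<bar>real (k n) / real n - alpha_c a v\<bar> = \<bar>real n - real (k n) * mean\<bar> / (real n * mean)"
      using elim mean_ge_1 by (simp add: abs_mult)
    also have "\<dots> \<le> \<bar>real n - real (k n) * mean\<bar> / real n"
      using elim mean_ge_1 by (intro divide_left_mono) auto
    also have "\<dots> \<le> K * (real n * err n) / real n" using le by (intro divide_right_mono) auto
    also have "\<dots> = K * err n" using elim by simp
    finally show ?case .
  qed
  with K(1) that show ?thesis by blast
qed

lemma fraction_tendsto: "(\<lambda>n. real (k n) / real n) \<longlonglongrightarrow> alpha_c a v"
proof -
  obtain K where K: "\<forall>\<^sub>F n in sequentially. \<bar>real (k n) / real n - alpha_c a v\<bar> \<le> K * err n"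
    using fraction_deviation by blast
  have "(\<lambda>n. real (k n) / real n - alpha_c a v) \<longlonglongrightarrow> 0"
  proof (rule Lim_null_comparison)
    show "(\<lambda>n. K * err n) \<longlonglongrightarrow> 0" using tendsto_mult_left[OF err_tendsto_0, of K] by simp
  qed (use K in simp)
  thus ?thesis by (rule LIM_zero_cancel)
qed

lemma bigo_omega:
  assumes "\<forall>\<^sub>F n in sequentially. \<bar>f n\<bar> \<le> K * err n" "K > 0"
  shows "f \<in> O(omega a v \<rho>)"
proof (rule bigoI)
  show "\<forall>\<^sub>F n in sequentially. norm (f n) \<le> K * norm (omega a v \<rho> n)"
    using assms(1)
  proof eventually_elim
    case (elim n)
    have "K * err n \<le> K * \<bar>omega a v \<rho> n\<bar>"
      using sqrt_cost_le_omega[of n] assms(2) by (intro mult_left_mono) (auto simp: err_def)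
    thus ?case using elim by simp
  qed
qed

lemma fraction_bigo: "(\<lambda>n. real (k n) / real n - alpha_c a v) \<in> O(omega a v \<rho>)"
  using fraction_deviation bigo_omega by metis

text \<open>
  The extremal test function is evaluated on \<open>k div r\<close> disjoint blocks. They all have the law of the first block,
  so the mean of the sum is the number of blocks times the distance, up to a factor 2.
\<close>

lemma d_TV_bigo:
  assumes r: "r \<ge> 1"
  shows "(\<lambda>n. d_TV (mu_marginal a v \<rho> n (k n) r) (replicate_pmf r q)) \<in> O(omega a v \<rho>)"
proof -
  obtain K where K: "K > 0" "\<forall>\<^sub>F n in sequentially. \<forall>b g. b * r \<le> k n \<longrightarrow> b \<le> n \<longrightarrow>
    (\<forall>\<theta>. \<bar>\<theta>\<bar> \<le> 1 \<longrightarrow> (\<integral>\<^sup>+ xs. ennreal (exp (\<theta> * g xs)) \<partial>replicate_pmf r q)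
        \<le> ennreal (exp ((2\<^sup>2 * exp 2) * \<theta>\<^sup>2)))
    \<longrightarrow> measure_pmf.expectation (\<mu> n) (\<lambda>js. \<bar>\<Sum>i<b. g (take r (drop (i * r) js))\<bar>) \<le> K * (real n * err n)"
  proof -
    have "(0::real) \<le> 2\<^sup>2 * exp 2" by simp
    from concentration[OF zero_less_one this] that show ?thesis by blast
  qed
  define \<beta> where "\<beta> = alpha_c a v / (4 * real r)"
  have beta: "\<beta> > 0" using mean_ge_1 r by (simp add: \<beta>_def alpha_c_eq)
  have al: "alpha_c a v > 0" using mean_ge_1 by (simp add: alpha_c_eq)
  have "\<forall>\<^sub>F n in sequentially. alpha_c a v / 2 < real (k n) / real n"
    using fraction_tendsto al by (intro order_tendstoD(1)) auto
  moreover have "\<forall>\<^sub>F n in sequentially. 1 < \<beta> * real n" using beta by (rule eventually_const_less_linear)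
  ultimately have "\<forall>\<^sub>F n in sequentially.
      \<bar>d_TV (mu_marginal a v \<rho> n (k n) r) (replicate_pmf r q)\<bar> \<le> K / \<beta> * err n"
    using K(2) W_pos eventually_ge_at_top[of 1]
  proof eventually_elim
    case (elim n)
    define P where "P = mu_marginal a v \<rho> n (k n) r"
    define Q where "Q = replicate_pmf r q"
    define sg where "sg z = sgn (pmf P z - pmf Q z)" for z
    have sg: "\<bar>sg z\<bar> \<le> 1" for z by (simp add: sg_def sgn_if)
    define g where "g z = sg z - measure_pmf.expectation Q sg" for z
    have int: "integrable (measure_pmf p) sg" for p
      using sg by (intro measure_pmf.integrable_const_bound[where B = 1]) auto
    have "\<bar>measure_pmf.expectation Q sg\<bar> \<le> 1"
    proof -
      have "\<bar>measure_pmf.expectation Q sg\<bar> \<le> measure_pmf.expectation Q (\<lambda>z. \<bar>sg z\<bar>)"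
        by (rule integral_abs_bound)
      also have "\<dots> \<le> measure_pmf.expectation Q (\<lambda>_. 1)"
        using sg int by (intro integral_mono) auto
      finally show ?thesis by simp
    qed
    hence g2: "\<bar>g z\<bar> \<le> 2" for z
      using sg[of z] unfolding g_def by linarith
    have g0: "measure_pmf.expectation Q g = 0" unfolding g_def using int by simp
    define b where "b = k n div r"
    have br: "b * r \<le> k n" by (simp add: b_def)
    have bn: "b \<le> n" unfolding b_def by (rule order_trans[OF div_le_dividend k_bounds(2)[OF elim(5)]])
    have b_ge: "\<beta> * real n \<le> real b"
    proof -
      have "k n < (b + 1) * r" using r by (simp add: b_def dividend_less_div_times)
      hence "real (k n) < real ((b + 1) * r)" by (rule of_nat_less_iff[THEN iffD2])
      hence "real (k n) < (real b + 1) * real r" by (simp add: algebra_simps)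
      moreover have "alpha_c a v / 2 * real n < real (k n)"
        using elim by (simp add: field_simps)
      ultimately have "alpha_c a v / 2 * real n < (real b + 1) * real r" by linarith
      hence "2 * \<beta> * real n < real b + 1" using r by (simp add: \<beta>_def field_simps)
      thus ?thesis using elim(2) by linarith
    qed
    have "real b * \<bar>measure_pmf.expectation P g\<bar>
        = \<bar>measure_pmf.expectation (\<mu> n) (\<lambda>js. \<Sum>i<b. g (take r (drop (i * r) js)))\<bar>"
    proof -
      have fin: "integrable (measure_pmf (\<mu> n)) h" for h :: "nat list \<Rightarrow> real"
        by (rule integrable_measure_pmf_finite[OF finite_set_pmf_mu[OF elim(4)]])
      have "measure_pmf.expectation (\<mu> n) (\<lambda>js. \<Sum>i<b. g (take r (drop (i * r) js)))
          = (\<Sum>i<b. measure_pmf.expectation (\<mu> n) (\<lambda>js. g (take r (drop (i * r) js))))"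
        by (intro Bochner_Integration.integral_sum fin)
      also have "\<dots> = (\<Sum>i<b. measure_pmf.expectation P g)"
        unfolding P_def
      proof (intro sum.cong refl expectation_mu_block elim)
        fix i assume "i \<in> {..<b}"
        hence "Suc i * r \<le> b * r" by (intro mult_le_mono1) simp
        thus "Suc i * r \<le> k n" using br by (rule order_trans)
      qed
      finally show ?thesis by (simp add: abs_mult)
    qed
    also have "\<dots> \<le> measure_pmf.expectation (\<mu> n) (\<lambda>js. \<bar>\<Sum>i<b. g (take r (drop (i * r) js))\<bar>)"
      by (rule integral_abs_bound)
    also have "\<dots> \<le> K * (real n * err n)"
      using nn_integral_exp_le_bounded[OF g2 g0] by (intro elim(3)[rule_format] br bn) (auto simp: Q_def)
    finally have main: "real b * \<bar>measure_pmf.expectation P g\<bar> \<le> K * (real n * err n)" .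
    have "measure_pmf.expectation P g = measure_pmf.expectation P sg - measure_pmf.expectation Q sg"
      unfolding g_def using int by simp
    hence "\<bar>d_TV P Q\<bar> \<le> \<bar>measure_pmf.expectation P g\<bar>"
      using d_TV_eq_expectation_diff[of P Q] unfolding sg_def by simp
    moreover have "\<beta> * real n * \<bar>measure_pmf.expectation P g\<bar> \<le> real b * \<bar>measure_pmf.expectation P g\<bar>"
      using b_ge by (intro mult_right_mono) auto
    ultimately have "\<beta> * real n * \<bar>d_TV P Q\<bar> \<le> K * (real n * err n)"
      using main beta by (meson mult_left_mono mult_nonneg_nonneg less_imp_le of_nat_0_le_iff order_trans)
    hence "real n * (\<beta> * \<bar>d_TV P Q\<bar>) \<le> real n * (K * err n)" by (simp add: mult_ac)
    hence "\<beta> * \<bar>d_TV P Q\<bar> \<le> K * err n" using elim(5) by (simp add: mult_le_cancel_left_pos)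
    thus ?case using beta unfolding P_def[symmetric] Q_def[symmetric] by (simp add: field_simps)
  qed
  thus ?thesis using K(1) beta by (intro bigo_omega[where K = "K / \<beta>"]) auto
qed

definition bulk :: "nat \<Rightarrow> nat \<Rightarrow> real"
  where "bulk M j = (if j \<le> M then v j else 0)"

definition bulk_mean :: "nat \<Rightarrow> real"
  where "bulk_mean M = measure_pmf.expectation q (bulk M)"

lemma bulk_mean_tendsto: "bulk_mean \<longlonglongrightarrow> rho_c a v * mean"
proof -
  have "(\<lambda>M. measure_pmf.expectation q (bulk M)) \<longlonglongrightarrow> measure_pmf.expectation q v"
  proof (rule integral_dominated_convergence[where w = "\<lambda>j. \<bar>v j\<bar>"])
    show "AE j in q. (\<lambda>M. bulk M j) \<longlonglongrightarrow> v j"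
    proof (rule AE_I2)
      fix j
      have "\<forall>\<^sub>F M in sequentially. bulk M j = v j"
        using eventually_ge_at_top[of j] by eventually_elim (simp add: bulk_def)
      thus "(\<lambda>M. bulk M j) \<longlonglongrightarrow> v j" by (rule tendsto_eventually)
    qed
  qed (use integrable_v in \<open>auto simp: bulk_def\<close>)
  thus ?thesis by (simp add: bulk_mean_def[abs_def] expectation_v)
qed

lemma sum_large_idx:
  "(\<Sum>i\<in>large_idx (real M) js. v (js ! i)) = sum_list (map v js) - sum_list (map (bulk M) js)"
proof -
  have "sum_list (map v js) - sum_list (map (bulk M) js) = (\<Sum>i<length js. v (js ! i) - bulk M (js ! i))"
    by (simp add: sum_list_sum_nth atLeast0LessThan sum_subtractf)
  also have "\<dots> = (\<Sum>i\<in>large_idx (real M) js. v (js ! i))"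
    by (rule sum.mono_neutral_cong_right) (auto simp: large_idx_def bulk_def)
  finally show ?thesis by simp
qed

definition condensate_error :: "nat \<Rightarrow> nat \<Rightarrow> real"
  where "condensate_error n M = measure_pmf.expectation (\<mu> n)
    (\<lambda>js. \<bar>1 / real n * (\<Sum>i\<in>large_idx (real M) js. v (js ! i)) - (\<rho> - rho_c a v)\<bar>)"

lemma condensate_error_nonneg: "condensate_error n M \<ge> 0"
  unfolding condensate_error_def by (rule Bochner_Integration.integral_nonneg) auto

text \<open>
  The total of \<open>v\<close> is \<open>\<rho> n\<close> up to 1, and the truncated total concentrates around \<open>k * bulk_mean M\<close>; the difference is
  what the large coordinates carry.
\<close>

lemma condensate_error_le: obtains K where
  "\<forall>\<^sub>F n in sequentially. condensate_error n M
    \<le> 1 / real n + K * err n + \<bar>real (k n) / real n * bulk_mean M - rho_c a v\<bar>"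
proof -
  define B where "B = (\<Sum>j\<le>M. \<bar>v j\<bar>) + \<bar>bulk_mean M\<bar>"
  define f where "f j = bulk M j - bulk_mean M" for j
  have bb: "\<bar>bulk M j\<bar> \<le> (\<Sum>j\<le>M. \<bar>v j\<bar>)" for j
  proof (cases "j \<le> M")
    case True
    thus ?thesis unfolding bulk_def by (simp, intro member_le_sum) auto
  qed (auto simp: bulk_def intro!: sum_nonneg)
  have fB: "\<bar>f j\<bar> \<le> B" for j using bb[of j] unfolding f_def B_def by linarith
  have "integrable q (bulk M)" using bb by (intro measure_pmf.integrable_const_bound) auto
  hence f0: "measure_pmf.expectation q f = 0" unfolding f_def by (simp add: bulk_mean_def)
  have BB: "0 \<le> B\<^sup>2 * exp B" by simp
  obtain K where K: "\<forall>\<^sub>F n in sequentially.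
    measure_pmf.expectation (\<mu> n) (\<lambda>js. \<bar>sum_list (map f js)\<bar>) \<le> K * (real n * err n)"
    using concentration_sum_list[OF zero_less_one BB nn_integral_exp_le_bounded[OF fB f0]] by blast
  have "\<forall>\<^sub>F n in sequentially. condensate_error n M
    \<le> 1 / real n + K * err n + \<bar>real (k n) / real n * bulk_mean M - rho_c a v\<bar>"
    using K W_pos eventually_ge_at_top[of 1]
  proof eventually_elim
    case (elim n)
    define c where "c = \<bar>real (k n) / real n * bulk_mean M - rho_c a v\<bar>"
    have fin: "integrable (measure_pmf (\<mu> n)) h" for h :: "nat list \<Rightarrow> real"
      by (rule integrable_measure_pmf_finite[OF finite_set_pmf_mu[OF elim(2)]])
    have "condensate_error n M \<le> measure_pmf.expectation (\<mu> n)
        (\<lambda>js. 1 / real n + 1 / real n * \<bar>sum_list (map f js)\<bar> + c)"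
      unfolding condensate_error_def
    proof (intro integral_mono_AE fin, subst AE_measure_pmf_iff, intro ballI)
      fix js assume "js \<in> set_pmf (\<mu> n)"
      hence js: "length js = k n" "\<bar>sum_list (map v js) - \<rho> * real n\<bar> \<le> 1"
        using set_pmf_mu[OF elim(2)] by (auto simp: mem_constraint_set)
      have "sum_list (map f js) = sum_list (map (bulk M) js) - real (k n) * bulk_mean M"
        unfolding f_def sum_list_map_diff_const js(1) ..
      hence bulk_eq: "sum_list (map (bulk M) js) = sum_list (map f js) + real (k n) * bulk_mean M" by simp
      define x y z where "x = 1 / real n * (sum_list (map v js) - \<rho> * real n)"
        and "y = 1 / real n * sum_list (map f js)"
        and "z = real (k n) / real n * bulk_mean M - rho_c a v"
      have "1 / real n * (\<Sum>i\<in>large_idx (real M) js. v (js ! i)) - (\<rho> - rho_c a v) = x - y - z"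
        unfolding sum_large_idx bulk_eq x_def y_def z_def using elim(3) by (simp add: field_simps)
      moreover have "\<bar>x - y - z\<bar> \<le> \<bar>x\<bar> + \<bar>y\<bar> + \<bar>z\<bar>" by linarith
      moreover have "\<bar>x\<bar> \<le> 1 / real n"
        unfolding x_def using js(2) elim(3) by (simp add: abs_mult divide_right_mono)
      moreover have "\<bar>y\<bar> = 1 / real n * \<bar>sum_list (map f js)\<bar>" by (simp add: y_def abs_mult)
      ultimately show "\<bar>1 / real n * (\<Sum>i\<in>large_idx (real M) js. v (js ! i)) - (\<rho> - rho_c a v)\<bar>
          \<le> 1 / real n + 1 / real n * \<bar>sum_list (map f js)\<bar> + c"
        unfolding c_def z_def[symmetric] by simp
    qed
    also have "\<dots> = 1 / real n + 1 / real n * measure_pmf.expectation (\<mu> n) (\<lambda>js. \<bar>sum_list (map f js)\<bar>) + c"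
      by (simp add: fin)
    also have "1 / real n * measure_pmf.expectation (\<mu> n) (\<lambda>js. \<bar>sum_list (map f js)\<bar>)
        \<le> 1 / real n * (K * (real n * err n))"
      by (intro mult_left_mono elim) auto
    also have "\<dots> = K * err n" using elim by simp
    finally show ?case by (simp add: c_def)
  qed
  with that show ?thesis by blast
qed

lemma condensate_error_eventually_small:
  assumes "\<epsilon> > 0"
  shows "\<exists>M0. \<forall>M\<ge>M0. \<forall>\<^sub>F n in sequentially. \<bar>condensate_error n M\<bar> < \<epsilon>"
proof -
  have "(\<lambda>M. \<bar>alpha_c a v * bulk_mean M - rho_c a v\<bar>) \<longlonglongrightarrow> \<bar>alpha_c a v * (rho_c a v * mean) - rho_c a v\<bar>"
    by (intro tendsto_intros bulk_mean_tendsto)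
  moreover have "alpha_c a v * (rho_c a v * mean) - rho_c a v = 0"
    using mean_ge_1 by (simp add: alpha_c_eq)
  ultimately have "(\<lambda>M. \<bar>alpha_c a v * bulk_mean M - rho_c a v\<bar>) \<longlonglongrightarrow> 0" by simp
  hence "\<forall>\<^sub>F M in sequentially. \<bar>alpha_c a v * bulk_mean M - rho_c a v\<bar> < \<epsilon>"
    using assms by (rule order_tendstoD)
  then obtain M0 where M0: "\<And>M. M \<ge> M0 \<Longrightarrow> \<bar>alpha_c a v * bulk_mean M - rho_c a v\<bar> < \<epsilon>"
    by (auto simp: eventually_sequentially)
  have "\<forall>\<^sub>F n in sequentially. \<bar>condensate_error n M\<bar> < \<epsilon>" if M: "M \<ge> M0" for M
  proof -
    obtain K where K: "\<forall>\<^sub>F n in sequentially. condensate_error n M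
      \<le> 1 / real n + K * err n + \<bar>real (k n) / real n * bulk_mean M - rho_c a v\<bar>"
      by (rule condensate_error_le)
    have "(\<lambda>n. 1 / real n + K * err n + \<bar>real (k n) / real n * bulk_mean M - rho_c a v\<bar>)
        \<longlonglongrightarrow> 0 + K * 0 + \<bar>alpha_c a v * bulk_mean M - rho_c a v\<bar>"
      by (intro tendsto_intros fraction_tendsto err_tendsto_0 lim_1_over_n)
    hence "\<forall>\<^sub>F n in sequentially.
        1 / real n + K * err n + \<bar>real (k n) / real n * bulk_mean M - rho_c a v\<bar> < \<epsilon>"
      using M0[OF M] by (intro order_tendstoD(2)) auto
    with K show ?thesis
      by eventually_elim (use condensate_error_nonneg in \<open>auto simp: abs_of_nonneg\<close>)
  qed
  thus ?thesis by blast
qed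

text \<open>
  The coordinates sum up to \<open>n\<close>, so at most \<open>n / M\<close> of them exceed \<open>M\<close>.
\<close>

lemma large_fraction_tendsto:
  assumes M: "filterlim M at_top sequentially"
  shows "(\<lambda>n. measure_pmf.expectation (\<mu> n)
    (\<lambda>js. real (card (large_idx (real (M n)) js)) / real (k n))) \<longlonglongrightarrow> 0"
proof (rule Lim_null_comparison)
  have al: "alpha_c a v > 0" using mean_ge_1 by (simp add: alpha_c_eq)
  have "(\<lambda>n. inverse (real (k n) / real n)) \<longlonglongrightarrow> inverse (alpha_c a v)"
    using al by (intro tendsto_inverse fraction_tendsto) auto
  moreover have "(\<lambda>n. inverse (real (M n))) \<longlonglongrightarrow> 0"
    by (intro tendsto_inverse_0_at_top filterlim_compose[OF filterlim_real_sequentially M])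
  ultimately have "(\<lambda>n. inverse (real (k n) / real n) * inverse (real (M n))) \<longlonglongrightarrow> inverse (alpha_c a v) * 0"
    by (rule tendsto_mult)
  thus "(\<lambda>n. inverse (real (k n) / real n) * inverse (real (M n))) \<longlonglongrightarrow> 0" by simp
  have "\<forall>\<^sub>F n in sequentially. M n \<ge> 1" using M by (auto simp: filterlim_at_top)
  thus "\<forall>\<^sub>F n in sequentially. norm (measure_pmf.expectation (\<mu> n)
      (\<lambda>js. real (card (large_idx (real (M n)) js)) / real (k n)))
      \<le> inverse (real (k n) / real n) * inverse (real (M n))"
    using W_pos eventually_ge_at_top[of 1]
  proof eventually_elim
    case (elim n)
    have fin: "integrable (measure_pmf (\<mu> n)) h" for h :: "nat list \<Rightarrow> real"
      by (rule integrable_measure_pmf_finite[OF finite_set_pmf_mu[OF elim(2)]])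
    let ?c = "\<lambda>js. real (card (large_idx (real (M n)) js)) / real (k n)"
    have "measure_pmf.expectation (\<mu> n) ?c \<le> measure_pmf.expectation (\<mu> n)
        (\<lambda>_. inverse (real (k n) / real n) * inverse (real (M n)))"
    proof (intro integral_mono_AE fin, subst AE_measure_pmf_iff, intro ballI)
      fix js assume "js \<in> set_pmf (\<mu> n)"
      hence js: "sum_list js = n" using set_pmf_mu[OF elim(2)] by (auto simp: mem_constraint_set)
      have "real (card (large_idx (real (M n)) js)) * real (M n)
          = (\<Sum>i\<in>large_idx (real (M n)) js. real (M n))" by simp
      also have "\<dots> \<le> (\<Sum>i\<in>large_idx (real (M n)) js. real (js ! i))"
        by (intro sum_mono) (auto simp: large_idx_def)
      also have "\<dots> \<le> (\<Sum>i<length js. real (js ! i))"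
        by (intro sum_mono2) (auto simp: large_idx_def)
      also have "\<dots> = real n"
        unfolding js[symmetric] sum_list_sum_nth atLeast0LessThan of_nat_sum ..
      finally have "real (card (large_idx (real (M n)) js)) \<le> real n / real (M n)"
        using elim(1) by (simp add: pos_le_divide_eq)
      hence "?c js \<le> real n / real (M n) / real (k n)" by (intro divide_right_mono) auto
      thus "?c js \<le> inverse (real (k n) / real n) * inverse (real (M n))"
        by (simp add: divide_inverse mult_ac)
    qed
    moreover have "measure_pmf.expectation (\<mu> n) ?c \<ge> 0"
      by (rule Bochner_Integration.integral_nonneg) auto
    ultimately show ?case by simp
  qed
qed

lemma condensate:
  "\<exists>M :: nat \<Rightarrow> real. filterlim M at_top sequentially
    \<and> (\<lambda>n. measure_pmf.expectation (\<mu> n)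
          (\<lambda>js. real (card (large_idx (M n) js)) / real (k n))) \<in> o(\<lambda>_. 1)
    \<and> (\<lambda>n. measure_pmf.expectation (\<mu> n)
          (\<lambda>js. \<bar>(1 / real n) * (\<Sum>i\<in>large_idx (M n) js. v (js ! i)) - (\<rho> - rho_c a v)\<bar>)) \<in> o(\<lambda>_. 1)"
proof -
  obtain m :: "nat \<Rightarrow> nat" where m: "filterlim m at_top sequentially"
    "(\<lambda>n. condensate_error n (m n)) \<longlonglongrightarrow> 0"
    by (rule diagonal_sequence[OF condensate_error_eventually_small])
  show ?thesis
  proof (intro exI[of _ "\<lambda>n. real (m n)"] conjI smalloI_tendsto)
    show "filterlim (\<lambda>n. real (m n)) at_top sequentially"
      by (rule filterlim_compose[OF filterlim_real_sequentially m(1)])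
  qed (use large_fraction_tendsto[OF m(1)] m(2) in \<open>simp_all add: condensate_error_def\<close>)
qed

end

theorem theorem3:
  fixes a v :: "nat \<Rightarrow> real" and \<rho> :: real and k :: "nat \<Rightarrow> nat"
  assumes "profile a v"
    and "\<rho> > rho_c a v" and "\<rho> > 0"
    and "\<And>n. n \<ge> 1 \<Longrightarrow> is_maximizer a v \<rho> n (k n)"
  shows "(\<forall>\<^sub>F n in sequentially. W a v \<rho> n (k n) > 0)
    \<and> ((\<lambda>n. real (k n) / real n) \<longlonglongrightarrow> alpha_c a v)
    \<and> (\<lambda>n. real (k n) / real n - alpha_c a v) \<in> O(omega a v \<rho>)
    \<and> (\<forall>r\<ge>1. (\<lambda>n. d_TV (mu_marginal a v \<rho> n (k n) r) (replicate_pmf r (q_c a v)))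
          \<in> O(omega a v \<rho>))
    \<and> (\<exists>M :: nat \<Rightarrow> real. filterlim M at_top sequentially
        \<and> (\<lambda>n. measure_pmf.expectation (mu a v \<rho> n (k n))
              (\<lambda>js. real (card (large_idx (M n) js)) / real (k n))) \<in> o(\<lambda>_. 1)
        \<and> (\<lambda>n. measure_pmf.expectation (mu a v \<rho> n (k n))
              (\<lambda>js. \<bar>(1 / real n) * (\<Sum>i\<in>large_idx (M n) js. v (js ! i))
                     - (\<rho> - rho_c a v)\<bar>)) \<in> o(\<lambda>_. 1))"
proof -
  interpret profile a v by (rule assms(1))
  interpret maximizing a v \<rho> k
    by unfold_locales (use assms(2,4) in auto)
  show ?thesis
    using W_pos fraction_tendsto fraction_bigo d_TV_bigo condensate by blast
qed

end
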